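(* Let $H$ be a separable infinite-dimensional complex Hilbert space and let ${\rm SA}(H)$ be the space of all (not necessarily bounded) self-adjoint operators on $H$, equipped with the strong resolvent topology. Let $E_{\rm dom}^{{\rm SA}(H)}$ be the equivalence relation on ${\rm SA}(H)$ given by $A\,E_{\rm dom}^{{\rm SA}(H)}\,B \iff \mathrm{dom}(A)=\mathrm{dom}(B)$, and let $E_{\ell^\infty}^{\mathbb{R}^{\mathbb{N}}}$ be the equivalence relation on $\mathbb{R}^{\mathbb{N}}$ given by $(a_n)_{n=1}^\infty\,E_{\ell^\infty}^{\mathbb{R}^{\mathbb{N}}}\,(b_n)_{n=1}^\infty \iff \sup_{n\in\mathbb{N}}|a_n-b_n|<\infty$. Then $E_{\rm dom}^{{\rm SA}(H)}$ is an $F_\sigma$ subset of ${\rm SA}(H)\times{\rm SA}(H)$, and $E_{\rm dom}^{{\rm SA}(H)}$ is continuously bireducible with $E_{\ell^\infty}^{\mathbb{R}^{\mathbb{N}}}$, i.e. $E_{\rm dom}^{{\rm SA}(H)}\le_c E_{\ell^\infty}^{\mathbb{R}^{\mathbb{N}}}$ and $E_{\ell^\infty}^{\mathbb{R}^{\mathbb{N}}}\le_c E_{\rm dom}^{{\rm SA}(H)}$.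
   Context: The strong resolvent topology (SRT) on ${\rm SA}(H)$ is the coarsest topology making $A\mapsto (A-i)^{-1}\in\mathbb{B}(H)$ continuous when $\mathbb{B}(H)$ carries the strong operator topology; with it ${\rm SA}(H)$ is a Polish space. $\mathbb{R}^{\mathbb{N}}$ carries the product topology. For equivalence relations $E$ on a Polish space $X$ and $F$ on a Polish space $Y$, $E\le_c F$ means there is a continuous map $f\colon X\to Y$ with $x E y\iff f(x) F f(y)$ for all $x,y\in X$. *)

theory Defs
  imports "HOL-Analysis.Analysis"
begin

section \<open>Complex Hilbert spaces\<close>

text \<open>
  The distribution has no class of complex inner product spaces. A complex Hilbert space is taken
  together with its underlying real Hilbert space, whose inner product is the real part of the
  complex one; positive definiteness, the norm \<open>sqrt (Re (cinner x x))\<close> and completeness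
  are therefore inherited from \<^class>\<open>real_inner\<close> and \<^class>\<open>banach\<close>. The inner product is linear in its first
  argument.
\<close>

class complex_hilbert = real_inner + banach +
  fixes scaleC :: "complex \<Rightarrow> 'a \<Rightarrow> 'a" (infixr "*\<^sub>C" 75)
    and cinner :: "'a \<Rightarrow> 'a \<Rightarrow> complex"
  assumes scaleC_add_right: "c *\<^sub>C (x + y) = c *\<^sub>C x + c *\<^sub>C y"
    and scaleC_add_left: "(c + d) *\<^sub>C x = c *\<^sub>C x + d *\<^sub>C x"
    and scaleC_scaleC: "c *\<^sub>C (d *\<^sub>C x) = (c * d) *\<^sub>C x"
    and scaleR_scaleC: "r *\<^sub>R x = complex_of_real r *\<^sub>C x"
    and cinner_add_left: "cinner (x + y) z = cinner x z + cinner y z"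
    and cinner_scaleC_left: "cinner (c *\<^sub>C x) y = c * cinner x y"
    and cinner_commute: "cinner x y = cnj (cinner y x)"
    and inner_eq_Re_cinner: "inner x y = Re (cinner x y)"

lemma scaleC_one: "1 *\<^sub>C x = (x :: 'a::complex_hilbert)"
  using scaleR_scaleC[of 1 x] by simp

global_interpretation complex_vector:
  vector_space "scaleC :: complex \<Rightarrow> 'a \<Rightarrow> 'a::complex_hilbert"
  by unfold_locales
    (simp_all add: scaleC_add_right scaleC_add_left scaleC_scaleC scaleC_one)


section \<open>Unbounded self-adjoint operators\<close>

text \<open>
  A not necessarily everywhere defined operator is a partial function, so that \<^const>\<open>dom\<close> is its
  domain and equality of operators includes equality of their domains.
\<close>

definition linear_operator :: "('a::complex_hilbert \<rightharpoonup> 'a) \<Rightarrow> bool" where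
  "linear_operator A \<longleftrightarrow>
     complex_vector.subspace (dom A) \<and>
     (\<forall>x\<in>dom A. \<forall>y\<in>dom A. the (A (x + y)) = the (A x) + the (A y)) \<and>
     (\<forall>c. \<forall>x\<in>dom A. the (A (c *\<^sub>C x)) = c *\<^sub>C the (A x))"

definition densely_defined :: "('a::complex_hilbert \<rightharpoonup> 'a) \<Rightarrow> bool" where
  "densely_defined A \<longleftrightarrow> closure (dom A) = UNIV"

text \<open>
  Only meaningful for densely defined \<open>A\<close>, where the vector \<open>z\<close> below is unique if it exists.
\<close>

definition adjoint_op :: "('a::complex_hilbert \<rightharpoonup> 'a) \<Rightarrow> ('a \<rightharpoonup> 'a)" where
  "adjoint_op A = (\<lambda>y.
     if \<exists>z. \<forall>x\<in>dom A. cinner (the (A x)) y = cinner x z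
     then Some (THE z. \<forall>x\<in>dom A. cinner (the (A x)) y = cinner x z)
     else None)"

definition SA :: "('a::complex_hilbert \<rightharpoonup> 'a) set" where
  "SA = {A. linear_operator A \<and> densely_defined A \<and> adjoint_op A = A}"


section \<open>The strong resolvent topology\<close>

text \<open>
  \<open>resolvent A z\<close> is the bounded, everywhere defined inverse of \<open>A - z\<close>; it is unspecified if there
  is none, but it exists for self-adjoint \<open>A\<close> and non-real \<open>z\<close>.
\<close>

definition resolvent :: "('a::complex_hilbert \<rightharpoonup> 'a) \<Rightarrow> complex \<Rightarrow> 'a \<Rightarrow>\<^sub>L 'a" where
  "resolvent A z = (THE R.
     (\<forall>y. blinfun_apply R y \<in> dom A \<and>
          the (A (blinfun_apply R y)) - z *\<^sub>C blinfun_apply R y = y) \<and>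
     (\<forall>x\<in>dom A. blinfun_apply R (the (A x) - z *\<^sub>C x) = x))"

text \<open>
  The pullback topology is the coarsest topology on \<open>SA\<close> making the map continuous. The type
  \<open>'a \<Rightarrow>\<^sub>L 'a\<close> consists of the bounded real-linear maps; the resolvents are complex-linear, and the
  strong operator topology on the complex-linear maps is the subspace topology, so the topology
  induced on \<open>SA\<close> is the same.
\<close>

definition SRT :: "('a::complex_hilbert \<rightharpoonup> 'a) topology" where
  "SRT = pullback_topology SA (\<lambda>A. resolvent A \<i>) strong_operator_topology"


section \<open>Equivalence relations and continuous reducibility\<close>

definition E_dom :: "(('a::complex_hilbert \<rightharpoonup> 'a) \<times> ('a \<rightharpoonup> 'a)) set" where
  "E_dom = {(A, B). A \<in> SA \<and> B \<in> SA \<and> dom A = dom B}"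

definition E_linf :: "((nat \<Rightarrow> real) \<times> (nat \<Rightarrow> real)) set" where
  "E_linf = {(a, b). bdd_above (range (\<lambda>n. \<bar>a n - b n\<bar>))}"

definition continuously_reducible ::
    "'x topology \<Rightarrow> ('x \<times> 'x) set \<Rightarrow> 'y topology \<Rightarrow> ('y \<times> 'y) set \<Rightarrow> bool" where
  "continuously_reducible X E Y F \<longleftrightarrow>
     (\<exists>f. continuous_map X Y f \<and>
          (\<forall>x\<in>topspace X. \<forall>y\<in>topspace X. (x, y) \<in> E \<longleftrightarrow> (f x, f y) \<in> F))"

end

theory Submission
  imports Defs
begin

text \<open>
  The domain of a self-adjoint \<open>A\<close> is the range of its resolvent \<open>R\<^sub>A = (A - \<i>)\<^sup>-\<^sup>1\<close>. As in Douglas' lemma,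
  \<open>dom A \<subseteq> dom B\<close> holds iff \<open>\<parallel>R\<^sub>A v\<parallel> \<le> C \<parallel>R\<^sub>B v\<parallel>\<close> for some \<open>C\<close> and all \<open>v\<close>: one direction is uniform
  boundedness, the other is the Riesz representation of \<open>x \<mapsto> \<langle>B x, y\<rangle>\<close> for \<open>y \<in> dom A\<close>. By density it is enough
  to let \<open>v\<close> range over a dense sequence \<open>c\<^sub>n\<close>, so \<open>A \<mapsto> (ln \<parallel>R\<^sub>A c\<^sub>n\<parallel>)\<^sub>n\<close> is a continuous reduction to
  \<open>E_linf\<close>, and \<open>E_dom\<close> inherits being \<open>F\<^sub>\<sigma>\<close>. Conversely, a sequence is sent to an operator that is
  diagonal on a fixed infinite orthonormal sequence, with eigenvalues \<open>exp (max 0 (\<plusminus>a\<^sub>n))\<close>, and zero on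
  the orthogonal complement of that sequence.
\<close>

section \<open>Complex inner products\<close>

lemma cinner_add_right: "cinner x (y + z) = cinner x y + cinner x (z::'a::complex_hilbert)"
  by (metis cinner_add_left cinner_commute complex_cnj_add)

lemma cinner_scaleC_right: "cinner x (c *\<^sub>C y) = cnj c * cinner x (y::'a::complex_hilbert)"
  by (metis cinner_commute cinner_scaleC_left complex_cnj_mult)

lemma cinner_scaleR_left: "cinner (r *\<^sub>R x) y = r *\<^sub>R cinner x (y::'a::complex_hilbert)"
  by (simp add: scaleR_scaleC cinner_scaleC_left scaleR_conv_of_real)

lemma cinner_scaleR_right: "cinner x (r *\<^sub>R y) = r *\<^sub>R cinner x (y::'a::complex_hilbert)"
  by (simp add: scaleR_scaleC cinner_scaleC_right scaleR_conv_of_real)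

lemma cinner_self: "cinner x x = complex_of_real ((norm (x::'a::complex_hilbert))\<^sup>2)"
proof (rule complex_eqI)
  show "Re (cinner x x) = Re (complex_of_real ((norm x)\<^sup>2))"
    by (simp flip: inner_eq_Re_cinner add: power2_norm_eq_inner)
  have "Im (cinner x x) = - Im (cinner x x)"
    by (metis cinner_commute cnj.simps(2))
  then show "Im (cinner x x) = Im (complex_of_real ((norm x)\<^sup>2))"
    by simp
qed

lemma norm_scaleC: "norm (c *\<^sub>C x) = cmod c * norm (x::'a::complex_hilbert)"
proof -
  have "cinner (c *\<^sub>C x) (c *\<^sub>C x) = c * cnj c * cinner x x"
    by (simp add: cinner_scaleC_left cinner_scaleC_right)
  then have "complex_of_real ((norm (c *\<^sub>C x))\<^sup>2) = complex_of_real ((cmod c * norm x)\<^sup>2)"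
    unfolding cinner_self complex_norm_square [symmetric] by (simp add: power_mult_distrib)
  then have "(norm (c *\<^sub>C x))\<^sup>2 = (cmod c * norm x)\<^sup>2"
    using of_real_eq_iff by blast
  then show ?thesis
    by simp
qed

text \<open>Multiplying \<open>x\<close> by a unimodular scalar makes the inner product real and
  nonnegative, so the Cauchy-Schwarz inequality of the underlying real space applies.\<close>

lemma norm_cinner_le: "cmod (cinner x y) \<le> norm x * norm (y::'a::complex_hilbert)"
proof (cases "cinner x y = 0")
  case False
  define u where "u = cnj (cinner x y) / cmod (cinner x y)"
  have u: "cmod u = 1"
    using False by (simp add: u_def norm_divide)
  have "cinner (u *\<^sub>C x) y = cnj (cinner x y) * cinner x y / cmod (cinner x y)"
    by (simp add: cinner_scaleC_left u_def)
  also have "\<dots> = cmod (cinner x y)"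
    using False by (simp add: complex_norm_square [symmetric] mult.commute power2_eq_square)
  finally have "cmod (cinner x y) = inner (u *\<^sub>C x) y"
    by (simp add: inner_eq_Re_cinner)
  also have "\<dots> \<le> norm (u *\<^sub>C x) * norm y"
    by (rule norm_cauchy_schwarz)
  finally show ?thesis
    by (simp add: norm_scaleC u)
qed simp

lemma bounded_bilinear_cinner:
  "bounded_bilinear (cinner :: 'a::complex_hilbert \<Rightarrow> 'a \<Rightarrow> complex)"
proof
  show "\<exists>K. \<forall>a b::'a. cmod (cinner a b) \<le> norm a * norm b * K"
    by (rule exI [of _ 1]) (simp add: norm_cinner_le)
qed (simp_all add: cinner_add_left cinner_add_right cinner_scaleR_left cinner_scaleR_right)

lemma bounded_bilinear_scaleC:
  "bounded_bilinear (scaleC :: complex \<Rightarrow> 'a \<Rightarrow> 'a::complex_hilbert)"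
proof
  show "\<exists>K. \<forall>(c::complex) b::'a. norm (c *\<^sub>C b) \<le> norm c * norm b * K"
    by (rule exI [of _ 1]) (simp add: norm_scaleC)
qed (simp_all add: scaleC_add_left scaleC_add_right scaleR_scaleC scaleC_scaleC
    scaleR_conv_of_real mult.commute)

interpretation cinner: bounded_bilinear cinner
  by (rule bounded_bilinear_cinner)

interpretation scaleC: bounded_bilinear scaleC
  by (rule bounded_bilinear_scaleC)

text \<open>A minimising sequence for \<open>\<parallel>x\<parallel>\<^sup>2 - 2 f x\<close> is Cauchy by the parallelogram law, whether or not the
  subspace is closed; its limit represents \<open>f\<close>.\<close>

lemma riesz_representation_on_subspace:
  fixes f :: "'a::{real_inner,banach} \<Rightarrow> real"
  assumes M: "subspace M"
    and add: "\<And>x y. x \<in> M \<Longrightarrow> y \<in> M \<Longrightarrow> f (x + y) = f x + f y"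
    and scale: "\<And>r x. x \<in> M \<Longrightarrow> f (r *\<^sub>R x) = r * f x"
    and bound: "\<And>x. x \<in> M \<Longrightarrow> f x \<le> K * norm x"
  obtains z where "z \<in> closure M" "\<And>x. x \<in> M \<Longrightarrow> f x = inner x z"
proof -
  define J where "J x = (norm x)\<^sup>2 - 2 * f x" for x
  have J_ge: "J x \<ge> - K\<^sup>2" if "x \<in> M" for x
    using bound [OF that] zero_le_power2 [of "norm x - K"]
    by (simp add: J_def power2_diff mult.commute)
  have bdd: "bdd_below (J ` M)"
    using J_ge by (meson bdd_below.I2)
  have ne: "J ` M \<noteq> {}"
    using subspace_0 [OF M] by auto
  define m where "m = Inf (J ` M)"
  have m_le: "m \<le> J x" if "x \<in> M" for x
    unfolding m_def using bdd that by (simp add: cINF_lower)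
  have "\<exists>x\<in>M. J x < m + inverse (Suc n)" for n
    using cInf_lessD [OF ne, of "m + inverse (Suc n)"] by (auto simp: m_def)
  then obtain X where X: "\<And>n. X n \<in> M" "\<And>n. J (X n) < m + inverse (Suc n)"
    by metis
  have dist: "(norm (X n - X k))\<^sup>2 \<le> 2 * inverse (Suc n) + 2 * inverse (Suc k)" for n k
  proof -
    let ?h = "(1/2) *\<^sub>R (X n + X k)"
    have h: "?h \<in> M"
      by (intro subspace_scale subspace_add M X)
    have fh: "2 * f ?h = f (X n) + f (X k)"
      using scale [of "X n + X k" "1/2"] subspace_add [OF M X(1) X(1)] add X(1) by simp
    have nh: "4 * (norm ?h)\<^sup>2 = (norm (X n + X k))\<^sup>2"
      by (simp add: power_mult_distrib power_divide)
    have "(norm (X n - X k))\<^sup>2 = 2 * (norm (X n))\<^sup>2 + 2 * (norm (X k))\<^sup>2 - 4 * (norm ?h)\<^sup>2"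
      unfolding nh by (simp add: power2_norm_eq_inner inner_simps inner_commute)
    also have "\<dots> = 2 * J (X n) + 2 * J (X k) - 4 * J ?h"
      using fh by (simp add: J_def)
    finally show ?thesis
      using X(2) [of n] X(2) [of k] m_le [OF h] by linarith
  qed
  have "Cauchy X"
  proof (rule CauchyI)
    fix e :: real assume e: "0 < e"
    obtain N where N: "inverse (Suc N) < e\<^sup>2 / 4"
      using reals_Archimedean [of "e\<^sup>2 / 4"] e by auto
    have "norm (X n - X k) < e" if "N \<le> n" "N \<le> k" for n k
    proof -
      have "inverse (Suc n) \<le> inverse (Suc N)" "inverse (Suc k) \<le> inverse (Suc N)"
        using that by (simp_all add: le_imp_inverse_le)
      then have "(norm (X n - X k))\<^sup>2 < e\<^sup>2"
        using dist [of n k] N by linarith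
      then show ?thesis
        using e by (simp add: power_less_imp_less_base)
    qed
    then show "\<exists>M. \<forall>m\<ge>M. \<forall>n\<ge>M. norm (X m - X n) < e"
      by blast
  qed
  then obtain z where z: "X \<longlonglongrightarrow> z"
    using Cauchy_convergent convergent_def by blast
  have "z \<in> closure M"
    using X(1) z closure_sequential by blast
  moreover have "f x = inner x z" if x: "x \<in> M" for x
  proof -
    define d where "d = inner z x - f x"
    \<comment> \<open>Minimality of \<open>m\<close> is tested along the line through
      \<open>X n\<close> in direction \<open>x\<close>; letting \<open>n\<close> tend to infinity
      leaves a quadratic in \<open>t\<close> that is nowhere negative.\<close>
    have quad: "2 * t * d + t\<^sup>2 * (norm x)\<^sup>2 \<ge> 0" for t
    proof -
      have "2 * t * (inner (X n) x - f x) + t\<^sup>2 * (norm x)\<^sup>2 \<ge> - inverse (Suc n)" for n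
      proof -
        have "m \<le> J (X n + t *\<^sub>R x)"
          by (intro m_le subspace_add subspace_scale M X x)
        also have "J (X n + t *\<^sub>R x) =
            J (X n) + 2 * t * (inner (X n) x - f x) + t\<^sup>2 * (norm x)\<^sup>2"
          using add [OF X(1) subspace_scale [OF M x]] scale [OF x]
            dot_norm [of "X n" "t *\<^sub>R x"]
          by (simp add: J_def power_mult_distrib algebra_simps)
        finally show ?thesis
          using X(2) [of n] by linarith
      qed
      moreover have "(\<lambda>n. 2 * t * (inner (X n) x - f x) + t\<^sup>2 * (norm x)\<^sup>2) \<longlonglongrightarrow>
          2 * t * d + t\<^sup>2 * (norm x)\<^sup>2"
        unfolding d_def by (intro tendsto_intros z)
      moreover have "(\<lambda>n. - inverse (real (Suc n))) \<longlonglongrightarrow> 0"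
        using tendsto_minus [OF LIMSEQ_inverse_real_of_nat] by simp
      ultimately show ?thesis
        using LIMSEQ_le [of "\<lambda>n. - inverse (real (Suc n))" 0] by blast
    qed
    have "d = 0"
    proof (cases "x = 0")
      case True
      then show ?thesis
        using scale [OF x, of 0] by (simp add: d_def)
    next
      case False
      \<comment> \<open>The quadratic attains its minimum at this \<open>t\<close>, and the minimum
        is negative unless \<open>d = 0\<close>.\<close>
      then have "2 * (- d / (norm x)\<^sup>2) * d + (- d / (norm x)\<^sup>2)\<^sup>2 * (norm x)\<^sup>2 = - (d\<^sup>2 / (norm x)\<^sup>2)"
        by (simp add: power2_eq_square field_simps)
      with quad [of "- d / (norm x)\<^sup>2"] have "d\<^sup>2 / (norm x)\<^sup>2 \<le> 0"
        by linarith
      with False show ?thesis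
        by (simp add: divide_le_0_iff)
    qed
    then show ?thesis
      by (simp add: d_def inner_commute)
  qed
  ultimately show thesis
    using that by blast
qed

section \<open>Self-adjoint operators and their resolvents\<close>

lemma cinner_eq_on_dense:
  assumes "closure D = (UNIV :: 'a::complex_hilbert set)"
    and "\<And>x. x \<in> D \<Longrightarrow> cinner x y = cinner x z"
  shows "y = z"
proof -
  have "closed {x. cinner x y = cinner x z}"
    by (intro closed_Collect_eq cinner.continuous_on continuous_intros)
  with assms have "cinner (y - z) y = cinner (y - z) z"
    using closure_minimal [of D "{x. cinner x y = cinner x z}"] by blast
  then have "cinner (y - z) (y - z) = 0"
    by (simp add: cinner.diff_right)
  then show ?thesis
    by (simp add: cinner_self)
qed

text \<open>Density of the domain makes the representing vector unique, so the definite description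
  returns it.\<close>

lemma adjoint_op_eq_Some_iff:
  assumes "densely_defined A"
  shows "adjoint_op A y = Some z \<longleftrightarrow> (\<forall>x\<in>dom A. cinner (the (A x)) y = cinner x z)"
proof -
  have "(THE z. \<forall>x\<in>dom A. cinner (the (A x)) y = cinner x z) = z"
    if "\<forall>x\<in>dom A. cinner (the (A x)) y = cinner x z" for z
  proof (rule the_equality [where P = "\<lambda>z. \<forall>x\<in>dom A. cinner (the (A x)) y = cinner x z", OF that])
    fix w assume "\<forall>x\<in>dom A. cinner (the (A x)) y = cinner x w"
    then show "w = z"
      using assms that by (intro cinner_eq_on_dense [of "dom A"]) (auto simp: densely_defined_def)
  qed
  then show ?thesis
    unfolding adjoint_op_def by (smt (verit) option.distinct(1) option.inject)
qed

text \<open>Unfolds the equality \<open>adjoint_op A = A\<close> pointwise: from left to right the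
  last clause is symmetry, from right to left it is maximality of the domain.\<close>

lemma SA_iff:
  "A \<in> SA \<longleftrightarrow> linear_operator A \<and> densely_defined A \<and>
    (\<forall>y z. A y = Some z \<longleftrightarrow> (\<forall>x\<in>dom A. cinner (the (A x)) y = cinner x z))"
proof -
  have "adjoint_op A = A \<longleftrightarrow> (\<forall>y z. A y = Some z \<longleftrightarrow> adjoint_op A y = Some z)"
    by (metis not_Some_eq ext)
  then have "A \<in> SA \<longleftrightarrow> linear_operator A \<and> densely_defined A \<and>
      (\<forall>y z. A y = Some z \<longleftrightarrow> adjoint_op A y = Some z)"
    unfolding SA_def by blast
  then show ?thesis
    by (cases "densely_defined A") (simp_all only: adjoint_op_eq_Some_iff simp_thms)
qed

lemma linear_operator_add:
  assumes "linear_operator A" "x \<in> dom A" "y \<in> dom A"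
  shows "x + y \<in> dom A" "the (A (x + y)) = the (A x) + the (A y)"
  using assms by (auto simp: linear_operator_def complex_vector.subspace_add)

lemma linear_operator_scaleC:
  assumes "linear_operator A" "x \<in> dom A"
  shows "c *\<^sub>C x \<in> dom A" "the (A (c *\<^sub>C x)) = c *\<^sub>C the (A x)"
  using assms by (auto simp: linear_operator_def complex_vector.subspace_scale)

lemma linear_operator_scaleR:
  assumes "linear_operator A" "x \<in> dom A"
  shows "r *\<^sub>R x \<in> dom A" "the (A (r *\<^sub>R x)) = r *\<^sub>R the (A x)"
  using linear_operator_scaleC [OF assms] by (simp_all add: scaleR_scaleC)

lemma linear_operator_diff:
  assumes "linear_operator A" "x \<in> dom A" "y \<in> dom A"
  shows "x - y \<in> dom A" "the (A (x - y)) = the (A x) - the (A y)"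
  using linear_operator_add [OF assms(1,2) linear_operator_scaleR(1) [OF assms(1,3), of "-1"]]
    linear_operator_scaleR(2) [OF assms(1,3), of "-1"] by simp_all

lemma linear_operator_zero:
  assumes "linear_operator A"
  shows "0 \<in> dom A"
  using assms by (auto simp: linear_operator_def complex_vector.subspace_0)

lemma linear_operator_subspace:
  assumes "linear_operator A"
  shows "subspace (dom A)"
  using linear_operator_add(1) linear_operator_scaleR(1) linear_operator_zero assms
  by (intro subspaceI)

lemma SA_linear: "A \<in> SA \<Longrightarrow> linear_operator A"
  by (simp add: SA_def)

lemma SA_symmetric:
  assumes "A \<in> SA" "x \<in> dom A" "y \<in> dom A"
  shows "cinner (the (A x)) y = cinner x (the (A y))"
  using assms by (metis SA_iff domD option.sel)

lemma SA_maximal: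
  assumes "A \<in> SA" "\<And>x. x \<in> dom A \<Longrightarrow> cinner (the (A x)) y = cinner x z"
  shows "y \<in> dom A" "the (A y) = z"
  using assms by (metis SA_iff domI option.sel)+

lemma symmetric_shift:
  assumes "\<And>x y. x \<in> dom A \<Longrightarrow> y \<in> dom A \<Longrightarrow> cinner (the (A x)) y = cinner x (the (A y))"
    and "x \<in> dom A" "y \<in> dom A"
  shows "cinner (the (A x) - z *\<^sub>C x) y = cinner x (the (A y) - cnj z *\<^sub>C y)"
  using assms
  by (simp add: cinner.diff_left cinner.diff_right cinner_scaleC_left cinner_scaleC_right)

text \<open>Symmetry makes \<open>cinner (the (A x)) x\<close> real, so only \<open>z\<close>
  contributes to the imaginary part of \<open>cinner (the (A x) - z *\<^sub>C x) x\<close>. For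
  nonreal \<open>z\<close> this gives injectivity of \<open>A - z\<close> and the bound on its
  inverse.\<close>

lemma symmetric_lower_bound:
  fixes A :: "'a::complex_hilbert \<rightharpoonup> 'a"
  assumes sym: "\<And>x y. x \<in> dom A \<Longrightarrow> y \<in> dom A \<Longrightarrow> cinner (the (A x)) y = cinner x (the (A y))"
    and x: "x \<in> dom A"
  shows "\<bar>Im z\<bar> * norm x \<le> norm (the (A x) - z *\<^sub>C x)"
proof (cases "x = 0")
  case False
  have "cinner (the (A x)) x = cnj (cinner (the (A x)) x)"
    using sym [OF x x] by (metis cinner_commute)
  then have "Im (cinner (the (A x)) x) = 0"
    by (metis Reals_cnj_iff complex_is_Real_iff)
  then have "\<bar>Im z\<bar> * (norm x)\<^sup>2 = \<bar>Im (cinner (the (A x) - z *\<^sub>C x) x)\<bar>"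
    by (simp add: cinner.diff_left cinner_scaleC_left cinner_self abs_mult)
  also have "\<dots> \<le> norm (the (A x) - z *\<^sub>C x) * norm x"
    using abs_Im_le_cmod norm_cinner_le order_trans by blast
  finally show ?thesis
    using False by (simp add: power2_eq_square mult.assoc [symmetric])
qed simp

text \<open>The basic criterion for self-adjointness: if both shifts of a symmetric operator are
  onto, its adjoint has no larger domain.\<close>

lemma SA_I:
  fixes A :: "'a::complex_hilbert \<rightharpoonup> 'a"
  assumes lin: "linear_operator A" and dense: "densely_defined A"
    and sym: "\<And>x y. x \<in> dom A \<Longrightarrow> y \<in> dom A \<Longrightarrow> cinner (the (A x)) y = cinner x (the (A y))"
    and surj: "\<And>y. \<exists>x\<in>dom A. the (A x) - z *\<^sub>C x = y"
    and surj': "\<And>y. \<exists>x\<in>dom A. the (A x) - cnj z *\<^sub>C x = y"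
  shows "A \<in> SA"
proof -
  have "A y = Some w" if w: "\<forall>x\<in>dom A. cinner (the (A x)) y = cinner x w" for y w
  proof -
    \<comment> \<open>\<open>u\<close> is the vector of \<open>dom A\<close> on which
      \<open>A - cnj z\<close> takes the value that the adjoint shift takes at \<open>y\<close>; the
      aim is \<open>y = u\<close>.\<close>
    obtain u where u: "u \<in> dom A" "the (A u) - cnj z *\<^sub>C u = w - cnj z *\<^sub>C y"
      using surj' by blast
    \<comment> \<open>Testing against a preimage of \<open>y - u\<close> under \<open>A - z\<close>
      shows that \<open>y - u\<close> is orthogonal to itself.\<close>
    obtain x where x: "x \<in> dom A" "the (A x) - z *\<^sub>C x = y - u"
      using surj by blast
    have "cinner (y - u) y = cinner x (w - cnj z *\<^sub>C y)"
      using w x(1) unfolding x(2) [symmetric]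
      by (simp add: cinner.diff_left cinner.diff_right cinner_scaleC_left cinner_scaleC_right)
    moreover have "cinner (y - u) u = cinner x (w - cnj z *\<^sub>C y)"
      using symmetric_shift [OF sym x(1) u(1), of z] x(2) u(2) by metis
    ultimately have "cinner (y - u) (y - u) = 0"
      by (simp add: cinner.diff_right)
    then have "y = u"
      by (simp add: cinner_self)
    with u show ?thesis
      by auto
  qed
  moreover have "\<forall>x\<in>dom A. cinner (the (A x)) y = cinner x w" if "A y = Some w" for y w
    using sym that by (metis domI option.sel)
  ultimately show ?thesis
    unfolding SA_iff using lin dense by blast
qed

section \<open>Closed graph and surjectivity of the nonreal shifts\<close>

text \<open>Passing to the limit in the symmetry relation with \<open>u\<close> fixed puts
  \<open>x\<close> into the domain of the adjoint, which is \<open>A\<close> itself.\<close>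

lemma SA_closed_graph:
  assumes A: "A \<in> SA" and X: "\<And>n. X n \<in> dom A" and x: "X \<longlonglongrightarrow> x"
    and y: "(\<lambda>n. the (A (X n))) \<longlonglongrightarrow> y"
  shows "x \<in> dom A" "the (A x) = y"
proof -
  have "cinner (the (A u)) x = cinner u y" if u: "u \<in> dom A" for u
  proof (rule LIMSEQ_unique)
    show "(\<lambda>n. cinner (the (A u)) (X n)) \<longlonglongrightarrow> cinner (the (A u)) x"
      by (intro cinner.tendsto tendsto_const x)
    show "(\<lambda>n. cinner (the (A u)) (X n)) \<longlonglongrightarrow> cinner u y"
      unfolding SA_symmetric [OF A u X] by (intro cinner.tendsto tendsto_const y)
  qed
  note * = this
  show "x \<in> dom A" "the (A x) = y"
    using SA_maximal [OF A *] by blast+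
qed

text \<open>The range of \<open>A - z\<close> is dense, since a vector orthogonal to it would be an
  eigenvector of \<open>A\<close> for \<open>cnj z\<close>; it is closed by the lower bound and the
  closed graph.\<close>

lemma SA_surj:
  fixes A :: "'a::complex_hilbert \<rightharpoonup> 'a"
  assumes A: "A \<in> SA" and z: "Im z \<noteq> 0"
  obtains x where "x \<in> dom A" "the (A x) - z *\<^sub>C x = y"
proof -
  note lin = SA_linear [OF A]
  define T where "T x = the (A x) - z *\<^sub>C x" for x
  have T_diff: "T (x - y) = T x - T y" if "x \<in> dom A" "y \<in> dom A" for x y
    using linear_operator_diff [OF lin that] by (simp add: T_def scaleC.diff_right)
  have T_add: "T (x + y) = T x + T y" if "x \<in> dom A" "y \<in> dom A" for x y
    using linear_operator_add [OF lin that] by (simp add: T_def scaleC_add_right)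
  have T_scaleC: "T (c *\<^sub>C x) = c *\<^sub>C T x" if "x \<in> dom A" for c x
    using linear_operator_scaleC [OF lin that]
    by (simp add: T_def scaleC.diff_right scaleC_scaleC mult.commute)
  define M where "M = T ` dom A"
  have M: "subspace M"
  proof (rule subspaceI)
    show "0 \<in> M"
      using T_scaleC [of 0 0] linear_operator_zero [OF lin]
      by (metis M_def imageI scaleC.zero_left)
    show "x + y \<in> M" if "x \<in> M" "y \<in> M" for x y
    proof -
      from that obtain u v where "x = T u" "y = T v" "u \<in> dom A" "v \<in> dom A"
        unfolding M_def by blast
      then show ?thesis
        unfolding M_def using linear_operator_add(1) [OF lin] T_add by (metis imageI)
    qed
    show "c *\<^sub>R x \<in> M" if "x \<in> M" for c x
    proof -
      from that obtain u where "x = T u" "u \<in> dom A"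
        unfolding M_def by blast
      then show ?thesis
        unfolding M_def scaleR_scaleC
        using linear_operator_scaleC(1) [OF lin] T_scaleC by (metis imageI)
    qed
  qed
  have "inner x y \<le> norm y * norm x" for x
    using norm_cauchy_schwarz [of x y] by (simp add: mult.commute)
  \<comment> \<open>\<open>w\<close> is the orthogonal projection of \<open>y\<close> onto the
    closure of the range.\<close>
  then obtain w where w: "w \<in> closure M" "\<And>x. x \<in> M \<Longrightarrow> inner x y = inner x w"
    using riesz_representation_on_subspace [OF M, of "\<lambda>x. inner x y" "norm y"]
    by (auto simp: inner_add_left)
  have "cinner (T x) (y - w) = 0" if x: "x \<in> dom A" for x
  proof (rule complex_eqI)
    \<comment> \<open>Real orthogonality to \<open>T x\<close> controls the real part only;
      orthogonality to \<open>-\<i> *\<^sub>C T x\<close>, which is also in the range, controls the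
      imaginary part.\<close>
    have "T x \<in> M" "T (-\<i> *\<^sub>C x) \<in> M"
      unfolding M_def by (intro imageI x linear_operator_scaleC(1) [OF lin x])+
    moreover have "T (-\<i> *\<^sub>C x) = -\<i> *\<^sub>C T x"
      by (rule T_scaleC [OF x])
    ultimately have "Re (cinner (T x) (y - w)) = 0" "Re (cinner (-\<i> *\<^sub>C T x) (y - w)) = 0"
      using w(2) by (metis inner_diff_right inner_eq_Re_cinner right_minus_eq)+
    then show "Re (cinner (T x) (y - w)) = Re 0" "Im (cinner (T x) (y - w)) = Im 0"
      unfolding cinner_scaleC_left by simp_all
  qed
  then have *: "cinner (the (A x)) (y - w) = cinner x (cnj z *\<^sub>C (y - w))" if "x \<in> dom A" for x
    using that by (simp add: T_def cinner.diff_left cinner_scaleC_left cinner_scaleC_right)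
  \<comment> \<open>A nonzero \<open>y - w\<close> would be an eigenvector for the nonreal number
    \<open>cnj z\<close>, which the lower bound forbids.\<close>
  have yw: "y - w \<in> dom A" "the (A (y - w)) = cnj z *\<^sub>C (y - w)"
    using SA_maximal [OF A *] by auto
  have "\<bar>Im (cnj z)\<bar> * norm (y - w) \<le> norm (the (A (y - w)) - cnj z *\<^sub>C (y - w))"
    by (rule symmetric_lower_bound [OF SA_symmetric [OF A] yw(1)])
  then have "\<bar>Im z\<bar> * norm (y - w) \<le> 0"
    unfolding yw(2) by simp
  then have "y = w"
    using z by (simp add: mult_le_0_iff)
  with w(1) have "y \<in> closure M"
    by simp
  then obtain Y where YM: "\<And>n. Y n \<in> M" and Y: "Y \<longlonglongrightarrow> y"
    unfolding closure_sequential by blast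
  have "\<forall>n. \<exists>x. x \<in> dom A \<and> Y n = T x"
    using YM unfolding M_def by blast
  then obtain X where X: "\<And>n. X n \<in> dom A" "\<And>n. Y n = T (X n)"
    unfolding choice_iff by blast
  \<comment> \<open>The lower bound carries the Cauchy property from the images \<open>Y\<close>
    back to the preimages \<open>X\<close>.\<close>
  have "Cauchy X"
  proof (rule CauchyI)
    fix e :: real assume e: "0 < e"
    then have "0 < \<bar>Im z\<bar> * e"
      using z by simp
    then obtain N where N: "\<And>m n. m \<ge> N \<Longrightarrow> n \<ge> N \<Longrightarrow> norm (Y m - Y n) < \<bar>Im z\<bar> * e"
      using CauchyD [OF LIMSEQ_imp_Cauchy [OF Y]] by blast
    have "norm (X m - X n) < e" if "m \<ge> N" "n \<ge> N" for m n
    proof -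
      have "\<bar>Im z\<bar> * norm (X m - X n) \<le> norm (T (X m - X n))"
        unfolding T_def
        by (rule symmetric_lower_bound [OF SA_symmetric [OF A] linear_operator_diff(1) [OF lin X(1) X(1)]])
      also have "\<dots> = norm (Y m - Y n)"
        unfolding X(2) T_diff [OF X(1) X(1)] ..
      also have "\<dots> < \<bar>Im z\<bar> * e"
        by (rule N [OF that])
      finally show ?thesis
        using z by simp
    qed
    then show "\<exists>M. \<forall>m\<ge>M. \<forall>n\<ge>M. norm (X m - X n) < e"
      by blast
  qed
  then obtain x where x: "X \<longlonglongrightarrow> x"
    using Cauchy_convergent convergent_def by blast
  have "(\<lambda>n. Y n + z *\<^sub>C X n) \<longlonglongrightarrow> y + z *\<^sub>C x"
    by (intro tendsto_add scaleC.tendsto tendsto_const x Y)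
  then have AX: "(\<lambda>n. the (A (X n))) \<longlonglongrightarrow> y + z *\<^sub>C x"
    unfolding X(2) T_def by simp
  show thesis
    using that SA_closed_graph [OF A X(1) x AX] by simp
qed

section \<open>Existence and basic identities of the resolvent\<close>

lemma resolvent_eqI:
  assumes "\<And>y. blinfun_apply R y \<in> dom A \<and>
      the (A (blinfun_apply R y)) - z *\<^sub>C blinfun_apply R y = y"
    and "\<And>x. x \<in> dom A \<Longrightarrow> blinfun_apply R (the (A x) - z *\<^sub>C x) = x"
  shows "resolvent A z = R"
  unfolding resolvent_def
proof (rule the_equality)
  fix R' :: "'a \<Rightarrow>\<^sub>L 'a"
  assume R': "(\<forall>y. blinfun_apply R' y \<in> dom A \<and>
          the (A (blinfun_apply R' y)) - z *\<^sub>C blinfun_apply R' y = y) \<and>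
     (\<forall>x\<in>dom A. blinfun_apply R' (the (A x) - z *\<^sub>C x) = x)"
  show "R' = R"
    by (rule blinfun_eqI) (metis R' assms(1))
qed (use assms in blast)

text \<open>Surjectivity supplies an inverse \<open>r\<close> of \<open>A - z\<close>. The lower
  bound makes preimages unique, which gives linearity, and bounds \<open>r\<close> by
  \<open>inverse \<bar>Im z\<bar>\<close>, so \<open>r\<close> is a bounded linear map and is the
  resolvent.\<close>

lemma SA_resolvent:
  fixes A :: "'a::complex_hilbert \<rightharpoonup> 'a"
  assumes A: "A \<in> SA" and z: "Im z \<noteq> 0"
  shows resolvent_in_dom: "blinfun_apply (resolvent A z) y \<in> dom A"
    and resolvent_right:
      "the (A (blinfun_apply (resolvent A z) y)) - z *\<^sub>C blinfun_apply (resolvent A z) y = y"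
    and resolvent_left: "x \<in> dom A \<Longrightarrow> blinfun_apply (resolvent A z) (the (A x) - z *\<^sub>C x) = x"
proof -
  note lin = SA_linear [OF A]
  have "\<forall>y. \<exists>x. x \<in> dom A \<and> the (A x) - z *\<^sub>C x = y"
    using SA_surj [OF A z] by blast
  then obtain r where r: "\<And>y. r y \<in> dom A" "\<And>y. the (A (r y)) - z *\<^sub>C r y = y"
    unfolding choice_iff by blast
  have r_eqI: "r y = x" if "x \<in> dom A" "the (A x) - z *\<^sub>C x = y" for x y
  proof -
    have "\<bar>Im z\<bar> * norm (r y - x) \<le> norm (the (A (r y - x)) - z *\<^sub>C (r y - x))"
      by (intro symmetric_lower_bound SA_symmetric A linear_operator_diff lin r that)
    also have "the (A (r y - x)) - z *\<^sub>C (r y - x) = 0"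
      using linear_operator_diff(2) [OF lin r(1) [of y] that(1)] r(2) [of y] that(2)
      by (simp add: scaleC.diff_right algebra_simps)
    finally show ?thesis
      using z by (simp add: mult_le_0_iff)
  qed
  have "bounded_linear r"
  proof
    show "r (x + y) = r x + r y" for x y
    proof (rule r_eqI)
      show "the (A (r x + r y)) - z *\<^sub>C (r x + r y) = x + y"
        using linear_operator_add(2) [OF lin r(1) [of x] r(1) [of y]] r(2) [of x] r(2) [of y]
        by (simp add: scaleC_add_right add_diff_add)
    qed (intro linear_operator_add lin r)
    show "r (c *\<^sub>R x) = c *\<^sub>R r x" for c x
    proof (rule r_eqI)
      show "the (A (c *\<^sub>R r x)) - z *\<^sub>C (c *\<^sub>R r x) = c *\<^sub>R x"
        unfolding linear_operator_scaleR(2) [OF lin r(1)] scaleC.scaleR_right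
          scaleR_diff_right [symmetric] r(2) ..
    qed (intro linear_operator_scaleR lin r)
    have "norm (r x) \<le> norm x * inverse \<bar>Im z\<bar>" for x
      using symmetric_lower_bound [OF SA_symmetric [OF A] r(1), of z x] r(2) [of x] z
      by (simp add: field_simps)
    then show "\<exists>K. \<forall>x. norm (r x) \<le> norm x * K"
      by blast
  qed
  then have apply_r: "blinfun_apply (Blinfun r) = r"
    by (rule bounded_linear_Blinfun_apply)
  have "resolvent A z = Blinfun r"
    by (rule resolvent_eqI) (auto simp: apply_r r intro: r_eqI)
  then show "blinfun_apply (resolvent A z) y \<in> dom A"
    "the (A (blinfun_apply (resolvent A z) y)) - z *\<^sub>C blinfun_apply (resolvent A z) y = y"
    "x \<in> dom A \<Longrightarrow> blinfun_apply (resolvent A z) (the (A x) - z *\<^sub>C x) = x"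
    by (auto simp: apply_r r intro: r_eqI)
qed

text \<open>Injectivity of the resolvent guarantees that the norms whose logarithms are taken later
  are positive at nonzero vectors.\<close>

lemma resolvent_eq_0_iff:
  assumes A: "A \<in> SA" and z: "Im z \<noteq> 0"
  shows "blinfun_apply (resolvent A z) y = 0 \<longleftrightarrow> y = 0"
  using resolvent_right [OF A z, of y] linear_operator_scaleR(2) [OF SA_linear [OF A]
      linear_operator_zero [OF SA_linear [OF A]], of 0]
  by (auto simp: blinfun.zero_right scaleC.zero_right)

lemma resolvent_adjoint:
  assumes A: "A \<in> SA" and z: "Im z \<noteq> 0"
  shows "cinner (blinfun_apply (resolvent A z) v) u =
    cinner v (blinfun_apply (resolvent A (cnj z)) u)"
proof -
  have z': "Im (cnj z) \<noteq> 0"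
    using z by simp
  show ?thesis
    using symmetric_shift [OF SA_symmetric [OF A] resolvent_in_dom [OF A z, of v]
        resolvent_in_dom [OF A z', of u], of z]
    by (simp add: resolvent_right [OF A z] resolvent_right [OF A z'])
qed

section \<open>Comparison of domains\<close>

text \<open>Baire category theorem: if every \<open>F n\<close> had empty interior, their union
  would too.\<close>

lemma baire_closed_cover:
  fixes F :: "nat \<Rightarrow> 'a::complete_space set"
  assumes closed: "\<And>n. closed (F n)" and cover: "(\<Union>n. F n) = UNIV"
  obtains n x r where "r > 0" "cball x r \<subseteq> F n"
proof -
  have cm: "completely_metrizable_space (euclidean :: 'a topology)"
    by (metis Met_TC.completely_metrizable_space_mtopology complete_UNIV mcomplete_iff_complete
        mtopology_is_euclidean)
  have "\<exists>n. interior (F n) \<noteq> {}"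
  proof (rule ccontr)
    assume "\<not> ?thesis"
    then have "(euclidean :: 'a topology) interior_of \<Union>(range F) = {}"
      using closed by (intro Baire_category_alt) (auto simp: cm)
    then show False
      using cover by simp
  qed
  then obtain n x where "x \<in> interior (F n)"
    by auto
  then show thesis
    using that by (meson mem_interior_cball)
qed

text \<open>Uniform boundedness principle: by Baire, one constant bounds all the functionals given
  by \<open>S\<close> on some ball, hence bounds their norms.\<close>

lemma uniform_bound_of_pointwise:
  fixes S :: "'a::complex_hilbert set"
  assumes "\<And>u. bdd_above ((\<lambda>x. cmod (cinner x u)) ` S)"
  obtains C where "\<And>x. x \<in> S \<Longrightarrow> norm x \<le> C"
proof -
  define F where "F n = (\<Inter>x\<in>S. {u. cmod (cinner x u) \<le> real n})" for n
  have "closed (F n)" for n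
    unfolding F_def
    by (intro closed_INT ballI closed_Collect_le continuous_intros cinner.continuous_on)
  moreover have "(\<Union>n. F n) = UNIV"
  proof -
    have "\<exists>n. u \<in> F n" for u
    proof -
      obtain K where K: "\<And>x. x \<in> S \<Longrightarrow> cmod (cinner x u) \<le> K"
        using assms [of u] by (auto simp: bdd_above_def)
      obtain n where "K \<le> real n"
        using real_arch_simple by blast
      with K have "u \<in> F n"
        unfolding F_def by (auto intro: order_trans)
      then show ?thesis
        by blast
    qed
    then show ?thesis
      by blast
  qed
  ultimately obtain n u r where r: "r > 0" and sub: "cball u r \<subseteq> F n"
    by (rule baire_closed_cover)
  have "norm x \<le> 2 * real n / r" if x: "x \<in> S" for x
  proof (cases "x = 0")
    case True
    with r show ?thesis
      by simp
  next
    case False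
    \<comment> \<open>\<open>w\<close> points along \<open>x\<close> with length \<open>r\<close>,
      so its inner product with \<open>x\<close> has modulus \<open>r * norm x\<close>; it is also a
      difference of two points of the ball.\<close>
    define w where "w = (r / norm x) *\<^sub>R x"
    have "u + w \<in> cball u r" "u \<in> cball u r"
      using r False by (auto simp: w_def dist_norm)
    moreover have "cmod (cinner x y) \<le> n" if "y \<in> cball u r" for y
      using that sub x unfolding F_def by blast
    ultimately have "cmod (cinner x (u + w)) \<le> n" "cmod (cinner x u) \<le> n"
      by blast+
    then have "cmod (cinner x w) \<le> 2 * real n"
      using norm_triangle_ineq4 [of "cinner x (u + w)" "cinner x u"]
      by (simp add: cinner_add_right)
    moreover have "cmod (cinner x w) = r * norm x"
      using r False
      by (simp add: w_def cinner_scaleR_right cinner_self power2_eq_square norm_mult)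
    ultimately show ?thesis
      using r by (simp add: field_simps)
  qed
  then show thesis
    by (rule that)
qed

text \<open>Moving both resolvents across the inner product writes \<open>cinner (?RA v) u\<close>
  as \<open>cinner (?RB v) w\<close>, with \<open>w\<close> depending on \<open>u\<close> only; the
  inclusion of domains is what makes \<open>w\<close> exist. Hence the vectors \<open>?RA v\<close>
  with \<open>norm (?RB v) \<le> 1\<close> are weakly bounded, so bounded in norm, and scaling gives
  the constant.\<close>

lemma resolvent_le_if_dom_subset:
  fixes A B :: "'a::complex_hilbert \<rightharpoonup> 'a"
  assumes A: "A \<in> SA" and B: "B \<in> SA" and z: "Im z \<noteq> 0" and sub: "dom A \<subseteq> dom B"
  obtains C where "\<And>v. norm (blinfun_apply (resolvent A z) v) \<le> C * norm (blinfun_apply (resolvent B z) v)"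
proof -
  have z': "Im (cnj z) \<noteq> 0"
    using z by simp
  let ?RA = "blinfun_apply (resolvent A z)" and ?RB = "blinfun_apply (resolvent B z)"
  have "bdd_above ((\<lambda>x. cmod (cinner x u)) ` (?RA ` {v. norm (?RB v) \<le> 1}))" for u
  proof -
    let ?y = "blinfun_apply (resolvent A (cnj z)) u"
    have y: "?y \<in> dom B"
      using resolvent_in_dom [OF A z'] sub by blast
    let ?w = "the (B ?y) - cnj z *\<^sub>C ?y"
    have "cmod (cinner (?RA v) u) \<le> norm ?w" if v: "norm (?RB v) \<le> 1" for v
    proof -
      have "cinner (?RA v) u = cinner v ?y"
        by (rule resolvent_adjoint [OF A z])
      also have "\<dots> = cinner (?RB v) ?w"
        using resolvent_adjoint [OF B z, of v ?w] resolvent_left [OF B z' y] by simp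
      finally have "cmod (cinner (?RA v) u) \<le> norm (?RB v) * norm ?w"
        using norm_cinner_le by metis
      also have "\<dots> \<le> 1 * norm ?w"
        using v by (intro mult_right_mono) auto
      finally show ?thesis
        by simp
    qed
    then show ?thesis
      by (auto simp: bdd_above_def)
  qed
  from uniform_bound_of_pointwise [OF this] obtain C
    where C: "\<And>x. x \<in> ?RA ` {v. norm (?RB v) \<le> 1} \<Longrightarrow> norm x \<le> C"
    by blast
  have "norm (?RA v) \<le> C * norm (?RB v)" for v
  proof (cases "?RB v = 0")
    case True
    then show ?thesis
      using resolvent_eq_0_iff [OF A z] resolvent_eq_0_iff [OF B z] by simp
  next
    case False
    have "norm (?RB (inverse (norm (?RB v)) *\<^sub>R v)) \<le> 1"
      using False by (simp add: blinfun.scaleR_right)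
    then have "norm (?RA (inverse (norm (?RB v)) *\<^sub>R v)) \<le> C"
      using C by blast
    then show ?thesis
      using False by (simp add: blinfun.scaleR_right field_simps)
  qed
  then show thesis
    by (rule that)
qed

text \<open>For \<open>y\<close> in \<open>dom A\<close> the functional sending \<open>x\<close> to
  \<open>cinner (the (B x)) y\<close> is bounded on \<open>dom B\<close>: with
  \<open>v = the (B x) - z *\<^sub>C x\<close> one has \<open>x = resolvent B z v\<close>, and the
  hypothesis bounds the resolvent of \<open>A\<close> at \<open>v\<close> by
  \<open>C * norm x\<close>. Riesz and maximality of \<open>B\<close> then put \<open>y\<close> into
  \<open>dom B\<close>.\<close>

lemma dom_subset_if_resolvent_le:
  fixes A B :: "'a::complex_hilbert \<rightharpoonup> 'a"
  assumes A: "A \<in> SA" and B: "B \<in> SA" and z: "Im z \<noteq> 0"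
    and le: "\<And>v. norm (blinfun_apply (resolvent A z) v) \<le> C * norm (blinfun_apply (resolvent B z) v)"
  shows "dom A \<subseteq> dom B"
proof
  fix y assume y: "y \<in> dom A"
  note lin = SA_linear [OF B]
  have z': "Im (cnj z) \<noteq> 0"
    using z by simp
  define u where "u = the (A y) - cnj z *\<^sub>C y"
  have bound: "inner (the (B x)) y \<le> (C * norm u + cmod z * norm y) * norm x" if x: "x \<in> dom B" for x
  proof -
    define v where "v = the (B x) - z *\<^sub>C x"
    have x_eq: "blinfun_apply (resolvent B z) v = x"
      unfolding v_def by (rule resolvent_left [OF B z x])
    have "cinner (the (B x)) y = cinner v y + cinner (z *\<^sub>C x) y"
      by (simp add: v_def cinner.diff_left)
    also have "cinner v y = cinner (blinfun_apply (resolvent A z) v) u"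
      using resolvent_adjoint [OF A z, of v u] resolvent_left [OF A z' y] by (simp add: u_def)
    finally have "inner (the (B x)) y \<le>
        cmod (cinner (blinfun_apply (resolvent A z) v) u + cinner (z *\<^sub>C x) y)"
      by (metis complex_Re_le_cmod inner_eq_Re_cinner)
    also have "\<dots> \<le> norm (blinfun_apply (resolvent A z) v) * norm u + norm (z *\<^sub>C x) * norm y"
      by (intro order_trans [OF norm_triangle_ineq] add_mono norm_cinner_le)
    also have "\<dots> \<le> (C * norm x) * norm u + (cmod z * norm x) * norm y"
      using le [of v] by (intro add_mono mult_right_mono) (auto simp: x_eq norm_scaleC)
    finally show ?thesis
      by (simp add: algebra_simps)
  qed
  obtain w where w: "\<And>x. x \<in> dom B \<Longrightarrow> inner (the (B x)) y = inner x w"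
  proof (rule riesz_representation_on_subspace [OF linear_operator_subspace [OF lin]])
    show "inner (the (B (x + x'))) y = inner (the (B x)) y + inner (the (B x')) y"
      if "x \<in> dom B" "x' \<in> dom B" for x x'
      unfolding linear_operator_add(2) [OF lin that] by (rule inner_add_left)
    show "inner (the (B (r *\<^sub>R x))) y = r * inner (the (B x)) y" if "x \<in> dom B" for r x
      unfolding linear_operator_scaleR(2) [OF lin that] by simp
  qed (use bound in blast)+
  have "cinner (the (B x)) y = cinner x w" if x: "x \<in> dom B" for x
  proof (rule complex_eqI)
    show "Re (cinner (the (B x)) y) = Re (cinner x w)"
      using w [OF x] by (simp add: inner_eq_Re_cinner)
    \<comment> \<open>The Riesz vector represents real parts only; the imaginary part is recovered
      by evaluating at \<open>\<i> *\<^sub>C x\<close>.\<close>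
    show "Im (cinner (the (B x)) y) = Im (cinner x w)"
      using w [of "\<i> *\<^sub>C x"] linear_operator_scaleC [OF lin x, of "\<i>"]
      by (simp add: inner_eq_Re_cinner cinner_scaleC_left)
  qed
  then show "y \<in> dom B"
    using SA_maximal(1) [OF B] by blast
qed

lemma dom_subset_iff_resolvent_le:
  assumes "A \<in> SA" "B \<in> SA" "Im z \<noteq> 0"
  shows "dom A \<subseteq> dom B \<longleftrightarrow> (\<exists>C. \<forall>v. norm (blinfun_apply (resolvent A z) v) \<le>
    C * norm (blinfun_apply (resolvent B z) v))"
  using assms dom_subset_if_resolvent_le resolvent_le_if_dom_subset by metis

section \<open>The logarithmic norms of the resolvent\<close>

lemma topspace_SRT: "topspace SRT = SA"
  by (simp add: SRT_def topspace_pullback_topology strong_operator_topology_topspace)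

lemma continuous_map_resolvent:
  "continuous_map SRT euclidean (\<lambda>A. blinfun_apply (resolvent A \<i>) x)"
  using continuous_map_pullback [OF strong_operator_topology_continuous_evaluation,
      of SA "\<lambda>A. resolvent A \<i>" x]
  by (simp add: SRT_def o_def)

text \<open>Since \<open>ln 0 = 0\<close>, a zero in the sequence \<open>c\<close> contributes a constant.\<close>

definition log_resolvent :: "(nat \<Rightarrow> 'a) \<Rightarrow> ('a::complex_hilbert \<rightharpoonup> 'a) \<Rightarrow> nat \<Rightarrow> real" where
  "log_resolvent c A n = ln (norm (blinfun_apply (resolvent A \<i>) (c n)))"

lemma continuous_map_log_resolvent_coordinate:
  "continuous_map SRT euclideanreal (\<lambda>A. log_resolvent c A n)"
proof (cases "c n = 0")
  case True
  then show ?thesis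
    by (simp add: log_resolvent_def blinfun.zero_right)
next
  case False
  have "continuous_map euclidean euclideanreal (norm :: 'a \<Rightarrow> real)"
    by (simp add: continuous_on_norm_id)
  then have "continuous_map SRT euclideanreal (\<lambda>A. norm (blinfun_apply (resolvent A \<i>) (c n)))"
    by (rule continuous_map_compose [OF continuous_map_resolvent, unfolded o_def])
  moreover have "norm (blinfun_apply (resolvent A \<i>) (c n)) > 0" if "A \<in> SA" for A
    using resolvent_eq_0_iff [OF that, of "\<i>" "c n"] False by simp
  \<comment> \<open>The norm map is restricted in its codomain to the positive reals, where
    \<open>ln\<close> is continuous.\<close>
  ultimately have "continuous_map SRT (top_of_set {0<..})
      (\<lambda>A. norm (blinfun_apply (resolvent A \<i>) (c n)))"
    by (auto simp: continuous_map_in_subtopology topspace_SRT)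
  moreover have "continuous_map (top_of_set {0<..}) euclideanreal ln"
    by (auto intro!: continuous_intros)
  ultimately show ?thesis
    unfolding log_resolvent_def by (rule continuous_map_compose [unfolded o_def])
qed

lemma continuous_map_log_resolvent:
  "continuous_map SRT (powertop_real UNIV) (log_resolvent c)"
  by (simp add: continuous_map_componentwise_UNIV continuous_map_log_resolvent_coordinate)

text \<open>Taking logarithms turns the factor comparing the resolvents into an additive constant.
  The comparison defines a closed set of vectors, so it extends from the dense sequence to the whole
  space.\<close>

lemma log_resolvent_le_iff:
  assumes A: "A \<in> SA" and B: "B \<in> SA" and dense: "closure (range c) = UNIV"
  shows "dom A \<subseteq> dom B \<longleftrightarrow> (\<exists>K. \<forall>n. log_resolvent c A n - log_resolvent c B n \<le> K)"
proof -
  let ?RA = "blinfun_apply (resolvent A \<i>)" and ?RB = "blinfun_apply (resolvent B \<i>)"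
  have pos: "norm (?RA (c n)) > 0" "norm (?RB (c n)) > 0" if "c n \<noteq> 0" for n
    using that resolvent_eq_0_iff [OF A] resolvent_eq_0_iff [OF B] by simp_all
  have "\<exists>K. \<forall>n. log_resolvent c A n - log_resolvent c B n \<le> K"
    if C: "\<forall>v. norm (?RA v) \<le> C * norm (?RB v)" for C
  proof (intro exI allI)
    fix n
    \<comment> \<open>The absolute value covers indices with \<open>c n = 0\<close>, where the
      difference is \<open>0\<close> while \<open>ln C\<close> may be negative.\<close>
    show "log_resolvent c A n - log_resolvent c B n \<le> \<bar>ln C\<bar>"
    proof (cases "c n = 0")
      case True
      then show ?thesis
        by (simp add: log_resolvent_def blinfun.zero_right)
    next
      case False
      note p = pos [OF this]
      have "0 < C * norm (?RB (c n))"
        using C p by (meson less_le_trans)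
      then have "0 < C"
        using p by (simp add: zero_less_mult_iff)
      have "ln (norm (?RA (c n))) \<le> ln (C * norm (?RB (c n)))"
        using C p \<open>0 < C * norm (?RB (c n))\<close> by simp
      also have "\<dots> = ln C + ln (norm (?RB (c n)))"
        using p \<open>0 < C\<close> by (simp add: ln_mult)
      finally show ?thesis
        by (simp add: log_resolvent_def)
    qed
  qed
  moreover have "\<forall>v. norm (?RA v) \<le> exp K * norm (?RB v)"
    if K: "\<forall>n. log_resolvent c A n - log_resolvent c B n \<le> K" for K
  proof -
    have "norm (?RA (c n)) \<le> exp K * norm (?RB (c n))" for n
    proof (cases "c n = 0")
      case True
      then show ?thesis
        by (simp add: blinfun.zero_right)
    next
      case False
      note p = pos [OF this]
      have "norm (?RA (c n)) = exp (log_resolvent c A n)"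
        using p by (simp add: log_resolvent_def)
      also have "\<dots> \<le> exp (K + log_resolvent c B n)"
        using K by (smt (verit) exp_le_cancel_iff)
      also have "\<dots> = exp K * norm (?RB (c n))"
        using p by (simp add: log_resolvent_def exp_add)
      finally show ?thesis .
    qed
    moreover have "closed {v. norm (?RA v) \<le> exp K * norm (?RB v)}"
      by (intro closed_Collect_le continuous_intros)
    ultimately show ?thesis
      using closure_minimal [of "range c" "{v. norm (?RA v) \<le> exp K * norm (?RB v)}"] dense
      by blast
  qed
  moreover have "dom A \<subseteq> dom B \<longleftrightarrow> (\<exists>C. \<forall>v. norm (?RA v) \<le> C * norm (?RB v))"
    by (rule dom_subset_iff_resolvent_le [OF A B]) simp
  ultimately show ?thesis
    by blast
qed

section \<open>The relation \<open>E_linf\<close> and its preimages\<close>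

text \<open>The two one-sided bounds correspond to the two inclusions between domains.\<close>

lemma E_linf_iff: "(a, b) \<in> E_linf \<longleftrightarrow> (\<exists>K. \<forall>n. a n - b n \<le> K) \<and> (\<exists>K. \<forall>n. b n - a n \<le> K)"
proof
  assume "(a, b) \<in> E_linf"
  then obtain K where "\<And>n. \<bar>a n - b n\<bar> \<le> K"
    by (auto simp: E_linf_def bdd_above_def)
  then have "a n - b n \<le> K" "b n - a n \<le> K" for n
    by (smt (verit))+
  then show "(\<exists>K. \<forall>n. a n - b n \<le> K) \<and> (\<exists>K. \<forall>n. b n - a n \<le> K)"
    by blast
next
  assume "(\<exists>K. \<forall>n. a n - b n \<le> K) \<and> (\<exists>K. \<forall>n. b n - a n \<le> K)"
  then obtain K L where KL: "\<And>n. a n - b n \<le> K" "\<And>n. b n - a n \<le> L"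
    by blast
  have "\<bar>a n - b n\<bar> \<le> max K L" for n
    using KL(1) [of n] KL(2) [of n] by linarith
  then show "(a, b) \<in> E_linf"
    by (auto simp: E_linf_def bdd_above_def)
qed

lemma E_dom_iff_log_resolvent:
  assumes "A \<in> SA" "B \<in> SA" "closure (range c) = UNIV"
  shows "(A, B) \<in> E_dom \<longleftrightarrow> (log_resolvent c A, log_resolvent c B) \<in> E_linf"
  using log_resolvent_le_iff [OF assms] log_resolvent_le_iff [OF assms(2,1,3)] assms
  by (auto simp: E_dom_def E_linf_iff)

text \<open>For each natural number \<open>K\<close> the pairs whose coordinates all differ by at
  most \<open>K\<close> form an intersection of closed sets; the preimage is the union over
  \<open>K\<close>.\<close>

lemma fsigma_in_vimage_E_linf:
  assumes f: "continuous_map X (powertop_real UNIV) f"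
  shows "fsigma_in (prod_topology X X)
    {(x, y). x \<in> topspace X \<and> y \<in> topspace X \<and> (f x, f y) \<in> E_linf}"
proof -
  let ?P = "prod_topology X X"
  define S where "S K = {p \<in> topspace ?P. \<forall>n. \<bar>f (fst p) n - f (snd p) n\<bar> \<le> real K}" for K :: nat
  have fn: "continuous_map X euclideanreal (\<lambda>x. f x n)" for n
    using f by (simp add: continuous_map_componentwise_UNIV)
  have "continuous_map ?P euclideanreal (\<lambda>p. \<bar>f (fst p) n - f (snd p) n\<bar>)" for n
    by (intro continuous_map_real_abs continuous_map_diff
        continuous_map_compose [OF continuous_map_fst fn, unfolded o_def]
        continuous_map_compose [OF continuous_map_snd fn, unfolded o_def])
  then have "closedin ?P {p \<in> topspace ?P. \<bar>f (fst p) n - f (snd p) n\<bar> \<in> {..real K}}" for n K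
    by (rule closedin_continuous_map_preimage) simp
  then have "closedin ?P (\<Inter>n. {p \<in> topspace ?P. \<bar>f (fst p) n - f (snd p) n\<bar> \<in> {..real K}})" for K
    by (intro closedin_Inter) auto
  moreover have "(\<Inter>n. {p \<in> topspace ?P. \<bar>f (fst p) n - f (snd p) n\<bar> \<in> {..real K}}) = S K" for K
    by (auto simp: S_def)
  ultimately have "fsigma_in ?P (\<Union>(range S))"
    by (intro fsigma_in_Union) (auto intro: closed_imp_fsigma_in)
  moreover have "\<Union>(range S) = {(x, y). x \<in> topspace X \<and> y \<in> topspace X \<and> (f x, f y) \<in> E_linf}"
  proof (intro equalityI subsetI)
    fix p assume "p \<in> {(x, y). x \<in> topspace X \<and> y \<in> topspace X \<and> (f x, f y) \<in> E_linf}"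
    then obtain x y K where p: "p = (x, y)" "x \<in> topspace X" "y \<in> topspace X"
      and K: "\<And>n. \<bar>f x n - f y n\<bar> \<le> K"
      by (auto simp: E_linf_def bdd_above_def)
    obtain k where "K \<le> real k"
      using real_arch_simple by blast
    then have "p \<in> S k"
      using K p by (auto simp: S_def intro: order_trans)
    then show "p \<in> \<Union>(range S)"
      by blast
  qed (auto simp: S_def E_linf_def bdd_above_def, blast)
  ultimately show ?thesis
    by simp
qed

lemma dense_sequence:
  assumes "separable_space (euclidean :: 'a topology)"
  obtains c :: "nat \<Rightarrow> 'a::topological_space" where "closure (range c) = UNIV"
proof -
  obtain C :: "'a set" where C: "countable C" "closure C = UNIV"
    using assms by (auto simp: separable_space_def)
  then have "C \<noteq> {}"
    by auto
  with C have "range (from_nat_into C) = C"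
    by simp
  with C show thesis
    using that by metis
qed

section \<open>Diagonal operators\<close>

lemma cmod_real_minus_ge: "\<bar>Im z\<bar> \<le> cmod (complex_of_real r - z)"
  using abs_Im_le_cmod [of "complex_of_real r - z"] by simp

text \<open>Writing the quotient as \<open>1 + z / (r - z)\<close> gives a bound independent of
  \<open>r\<close>, so unbounded eigenvalues still yield bounded multipliers.\<close>

lemma cmod_real_div_le:
  assumes "Im z \<noteq> 0"
  shows "cmod (complex_of_real r / (complex_of_real r - z)) \<le> 1 + cmod z / \<bar>Im z\<bar>"
proof -
  have ne: "complex_of_real r - z \<noteq> 0"
    using assms by (auto simp: complex_eq_iff)
  then have "r / (complex_of_real r - z) = 1 + z / (r - z)"
    by (simp add: field_simps)
  then have "cmod (r / (complex_of_real r - z)) \<le> 1 + cmod (z / (r - z))"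
    by (metis norm_one norm_triangle_ineq)
  also have "cmod (z / (complex_of_real r - z)) \<le> cmod z / \<bar>Im z\<bar>"
    unfolding norm_divide using assms ne by (intro divide_left_mono cmod_real_minus_ge mult_pos_pos) auto
  finally show ?thesis
    by simp
qed

text \<open>Gram-Schmidt: finitely many vectors never span, so a further vector can always be
  orthogonalised and normalised.\<close>

lemma ex_orthonormal_sequence:
  assumes inf: "\<nexists>B :: 'a::complex_hilbert set. finite B \<and> complex_vector.span B = UNIV"
  shows "\<exists>e :: nat \<Rightarrow> 'a. \<forall>m n. cinner (e m) (e n) = (if m = n then 1 else 0)"
proof -
  \<comment> \<open>\<open>P\<close> consults \<open>f\<close> only below \<open>n\<close>, as
    recursive choice along a wellorder requires.\<close>
  define P where "P f n v \<longleftrightarrow> cinner v v = 1 \<and> (\<forall>m<n. cinner v (f m) = 0)"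
    for f :: "nat \<Rightarrow> 'a" and n v
  have orth: "cinner (f k) (f l) = (if k = l then 1 else 0)"
    if "P f k (f k)" "P f l (f l)" for f k l
  proof -
    have "cinner (f k) (f l) = 0" if "l < k" "P f k (f k)" for k l
      using that by (simp add: P_def)
    moreover from this have "cinner (f k) (f l) = 0" if "k < l" "P f l (f l)" for k l
      using that by (metis cinner_commute complex_cnj_zero)
    ultimately show ?thesis
      using that by (metis P_def linorder_neqE_nat)
  qed
  have "\<exists>f. \<forall>n. P f n (f n)"
  proof (rule dependent_wellorder_choice)
    show "P f n v = P g n v" if "\<And>m. m < n \<Longrightarrow> f m = g m" for v f g n
      using that by (simp add: P_def)
    show "\<exists>v. P f n v" if P: "\<And>m. m < n \<Longrightarrow> P f m (f m)" for n f
    proof -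
      have "complex_vector.span (f ` {..<n}) \<noteq> UNIV"
        using inf by blast
      then obtain x where x: "x \<notin> complex_vector.span (f ` {..<n})"
        by blast
      \<comment> \<open>\<open>s\<close> is the projection of \<open>x\<close> onto the span of the
        earlier vectors; \<open>x - s\<close> is nonzero because \<open>x\<close> lies outside that
        span.\<close>
      define s where "s = (\<Sum>m<n. cinner x (f m) *\<^sub>C f m)"
      have "s \<in> complex_vector.span (f ` {..<n})"
        unfolding s_def
        by (intro complex_vector.span_sum complex_vector.span_scale complex_vector.span_base) simp
      with x have ne: "norm (x - s) \<noteq> 0"
        by auto
      have "cinner (x - s) (f k) = 0" if "k < n" for k
      proof -
        have "cinner s (f k) = (\<Sum>m<n. cinner x (f m) * cinner (f m) (f k))"
          by (simp add: s_def cinner.sum_left cinner_scaleC_left)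
        also have "\<dots> = (\<Sum>m<n. if m = k then cinner x (f m) else 0)"
          by (rule sum.cong) (simp_all add: orth P that)
        also have "\<dots> = cinner x (f k)"
          using that by simp
        finally show ?thesis
          by (simp add: cinner.diff_left)
      qed
      then have "P f n (inverse (norm (x - s)) *\<^sub>R (x - s))"
        using ne unfolding P_def cinner_self cinner_scaleR_left norm_scaleR by simp
      then show ?thesis
        by blast
    qed
  qed
  then show ?thesis
    using orth by blast
qed

section \<open>Series along an orthonormal sequence\<close>

locale orthonormal_sequence =
  fixes e :: "nat \<Rightarrow> 'a::complex_hilbert"
  assumes cinner_basis: "cinner (e m) (e n) = (if m = n then 1 else 0)"
begin

lemma norm_basis: "norm (e n) = 1"
proof -
  have "(norm (e n))\<^sup>2 = 1\<^sup>2"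
    using cinner_self [of "e n"] by (simp add: cinner_basis flip: of_real_power)
  then show ?thesis
    by (rule power2_eq_imp_eq) simp_all
qed

lemma norm_sum_basis:
  assumes "finite I"
  shows "(norm (\<Sum>n\<in>I. c n *\<^sub>C e n))\<^sup>2 = (\<Sum>n\<in>I. (cmod (c n))\<^sup>2)"
proof -
  have "complex_of_real ((norm (\<Sum>n\<in>I. c n *\<^sub>C e n))\<^sup>2) =
      (\<Sum>j\<in>I. \<Sum>i\<in>I. c i * (cnj (c j) * (if i = j then 1 else 0)))"
    unfolding cinner_self [symmetric]
    by (simp add: cinner.sum_left cinner.sum_right cinner_scaleC_left cinner_scaleC_right
        cinner_basis sum_distrib_left mult.left_commute)
  also have "\<dots> = (\<Sum>i\<in>I. c i * cnj (c i))"
    using assms by (simp add: if_distrib [of "\<lambda>t. _ * t"] cong: if_cong)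
  also have "\<dots> = complex_of_real (\<Sum>n\<in>I. (cmod (c n))\<^sup>2)"
    by (simp only: complex_norm_square of_real_sum)
  finally show ?thesis
    using of_real_eq_iff by blast
qed

text \<open>By Pythagoras the squared norm of each block of the vector series is the same block of
  the scalar series, so the Cauchy criteria agree.\<close>

lemma summable_basis_iff: "summable (\<lambda>n. c n *\<^sub>C e n) \<longleftrightarrow> summable (\<lambda>n. (cmod (c n))\<^sup>2)"
proof
  assume L: "summable (\<lambda>n. c n *\<^sub>C e n)"
  show "summable (\<lambda>n. (cmod (c n))\<^sup>2)"
    unfolding summable_Cauchy
  proof (intro allI impI)
    fix r :: real assume "0 < r"
    then obtain N where N: "\<And>m n. m \<ge> N \<Longrightarrow> norm (\<Sum>k=m..<n. c k *\<^sub>C e k) < sqrt r"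
      using L unfolding summable_Cauchy by (meson real_sqrt_gt_zero)
    have "norm (\<Sum>k=m..<n. (cmod (c k))\<^sup>2) < r" if "m \<ge> N" for m n
    proof -
      have "(norm (\<Sum>k=m..<n. c k *\<^sub>C e k))\<^sup>2 < (sqrt r)\<^sup>2"
        using N [OF that] by (intro power_strict_mono) auto
      with \<open>0 < r\<close> show ?thesis
        by (simp add: norm_sum_basis sum_nonneg)
    qed
    then show "\<exists>N. \<forall>m\<ge>N. \<forall>n. norm (\<Sum>k=m..<n. (cmod (c k))\<^sup>2) < r"
      by blast
  qed
next
  assume R: "summable (\<lambda>n. (cmod (c n))\<^sup>2)"
  show "summable (\<lambda>n. c n *\<^sub>C e n)"
    unfolding summable_Cauchy
  proof (intro allI impI)
    fix r :: real assume "0 < r"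
    then obtain N where N: "\<And>m n. m \<ge> N \<Longrightarrow> norm (\<Sum>k=m..<n. (cmod (c k))\<^sup>2) < r\<^sup>2"
      using R unfolding summable_Cauchy by (meson zero_less_power)
    have "norm (\<Sum>k=m..<n. c k *\<^sub>C e k) < r" if "m \<ge> N" for m n
    proof (rule power_less_imp_less_base)
      show "(norm (\<Sum>k=m..<n. c k *\<^sub>C e k))\<^sup>2 < r\<^sup>2"
        using N [OF that, of n] by (simp add: norm_sum_basis)
    qed (use \<open>0 < r\<close> in simp)
    then show "\<exists>N. \<forall>m\<ge>N. \<forall>n. norm (\<Sum>k=m..<n. c k *\<^sub>C e k) < r"
      by blast
  qed
qed

text \<open>Bessel's inequality: the projection \<open>p\<close> onto the first \<open>N\<close>
  vectors satisfies \<open>inner x p = (norm p)\<^sup>2\<close>, so it is no longer than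
  \<open>x\<close>.\<close>

lemma summable_bessel: "summable (\<lambda>n. (cmod (cinner x (e n)))\<^sup>2)"
proof (rule summableI_nonneg_bounded)
  fix N
  define p where "p = (\<Sum>n<N. cinner x (e n) *\<^sub>C e n)"
  have p: "(norm p)\<^sup>2 = (\<Sum>n<N. (cmod (cinner x (e n)))\<^sup>2)"
    unfolding p_def by (rule norm_sum_basis) simp
  have "cinner x p = complex_of_real (\<Sum>n<N. (cmod (cinner x (e n)))\<^sup>2)"
    unfolding p_def of_real_sum complex_norm_square
    by (simp add: cinner.sum_right cinner_scaleC_right mult.commute)
  then have "inner x p = (norm p)\<^sup>2"
    unfolding p inner_eq_Re_cinner by simp
  then have "(norm p)\<^sup>2 = (norm x)\<^sup>2 - (norm (x - p))\<^sup>2"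
    using dot_norm_neg [of x p] by simp
  then have "(norm p)\<^sup>2 \<le> (norm x)\<^sup>2"
    using zero_le_power2 [of "norm (x - p)"] by linarith
  then show "(\<Sum>n<N. (cmod (cinner x (e n)))\<^sup>2) \<le> (norm x)\<^sup>2"
    by (simp only: p)
qed simp

lemma cinner_suminf_basis:
  assumes "summable (\<lambda>n. c n *\<^sub>C e n)"
  shows "cinner (\<Sum>n. c n *\<^sub>C e n) (e m) = c m"
proof -
  have "cinner (\<Sum>n. c n *\<^sub>C e n) (e m) = (\<Sum>n. cinner (c n *\<^sub>C e n) (e m))"
    by (rule bounded_linear.suminf [OF cinner.bounded_linear_left assms])
  also have "(\<lambda>n. cinner (c n *\<^sub>C e n) (e m)) = (\<lambda>n. if n = m then c n else 0)"
    by (auto simp: cinner_scaleC_left cinner_basis)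
  also have "suminf \<dots> = c m"
    by (rule sums_unique [symmetric, OF sums_single])
  finally show ?thesis .
qed

lemma summable_multiplier:
  assumes "\<And>n. cmod (d n) \<le> K"
  shows "summable (\<lambda>n. (d n * cinner x (e n)) *\<^sub>C e n)"
proof -
  have "norm ((cmod (d n * cinner x (e n)))\<^sup>2) \<le> K\<^sup>2 * (cmod (cinner x (e n)))\<^sup>2" for n
    using assms [of n] by (simp add: norm_mult power_mult_distrib mult_right_mono power_mono)
  then have "summable (\<lambda>n. (cmod (d n * cinner x (e n)))\<^sup>2)"
    by (intro summable_comparison_test' [OF summable_mult [OF summable_bessel], of 0])
  then show ?thesis
    by (simp only: summable_basis_iff)
qed

text \<open>The domain is the largest one on which the series makes sense, as self-adjointness
  demands. Vectors orthogonal to the sequence lie in the kernel, so an incomplete sequence is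
  allowed.\<close>

definition diag :: "(nat \<Rightarrow> real) \<Rightarrow> 'a \<rightharpoonup> 'a" where
  "diag l x = (if summable (\<lambda>n. (complex_of_real (l n) * cinner x (e n)) *\<^sub>C e n)
     then Some (\<Sum>n. (complex_of_real (l n) * cinner x (e n)) *\<^sub>C e n) else None)"

lemma in_dom_diag:
  "x \<in> dom (diag l) \<longleftrightarrow> summable (\<lambda>n. (complex_of_real (l n) * cinner x (e n)) *\<^sub>C e n)"
  by (auto simp: diag_def dom_def split: if_splits)

lemma the_diag:
  "x \<in> dom (diag l) \<Longrightarrow> the (diag l x) = (\<Sum>n. (complex_of_real (l n) * cinner x (e n)) *\<^sub>C e n)"
  unfolding in_dom_diag by (simp add: diag_def)

lemma linear_operator_diag: "linear_operator (diag l)"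
proof -
  let ?T = "\<lambda>x n. (complex_of_real (l n) * cinner x (e n)) *\<^sub>C e n"
  have add: "?T (x + y) = (\<lambda>n. ?T x n + ?T y n)" for x y
    by (simp add: cinner_add_left scaleC_add_left distrib_left)
  have scale: "?T (c *\<^sub>C x) = (\<lambda>n. c *\<^sub>C ?T x n)" for c x
    by (simp add: cinner_scaleC_left scaleC_scaleC mult.left_commute)
  have dom_add: "x + y \<in> dom (diag l)" if "x \<in> dom (diag l)" "y \<in> dom (diag l)" for x y
    using that unfolding in_dom_diag add by (rule summable_add)
  have dom_scale: "c *\<^sub>C x \<in> dom (diag l)" if "x \<in> dom (diag l)" for c x
    using that unfolding in_dom_diag scale
    by (rule bounded_linear.summable [OF scaleC.bounded_linear_right])
  have "0 \<in> dom (diag l)"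
    unfolding in_dom_diag by (simp add: cinner.zero_left scaleC.zero_left)
  with dom_add dom_scale have "complex_vector.subspace (dom (diag l))"
    by (intro complex_vector.subspaceI)
  moreover have "the (diag l (x + y)) = the (diag l x) + the (diag l y)"
    if "x \<in> dom (diag l)" "y \<in> dom (diag l)" for x y
    unfolding the_diag [OF that(1)] the_diag [OF that(2)] the_diag [OF dom_add [OF that]] add
    using that unfolding in_dom_diag by (rule suminf_add [symmetric])
  moreover have "the (diag l (c *\<^sub>C x)) = c *\<^sub>C the (diag l x)" if "x \<in> dom (diag l)" for c x
    unfolding the_diag [OF that] the_diag [OF dom_scale [OF that]] scale
    using that unfolding in_dom_diag
    by (rule bounded_linear.suminf [OF scaleC.bounded_linear_right, symmetric])
  ultimately show ?thesis
    unfolding linear_operator_def by blast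
qed

lemma diag_symmetric:
  assumes x: "x \<in> dom (diag l)" and y: "y \<in> dom (diag l)"
  shows "cinner (the (diag l x)) y = cinner x (the (diag l y))"
proof -
  have "cinner (the (diag l x)) y = (\<Sum>n. cinner ((complex_of_real (l n) * cinner x (e n)) *\<^sub>C e n) y)"
    unfolding the_diag [OF x]
    using x unfolding in_dom_diag by (rule bounded_linear.suminf [OF cinner.bounded_linear_left])
  also have "\<dots> = (\<Sum>n. cinner x ((complex_of_real (l n) * cinner y (e n)) *\<^sub>C e n))"
    by (simp add: cinner_scaleC_left cinner_scaleC_right cinner_commute [of _ y] mult_ac)
  also have "\<dots> = cinner x (the (diag l y))"
    unfolding the_diag [OF y]
    using y unfolding in_dom_diag
    by (rule bounded_linear.suminf [OF cinner.bounded_linear_right, symmetric])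
  finally show ?thesis .
qed

text \<open>Deleting the tail of the expansion of \<open>x\<close>, while keeping its component
  orthogonal to the sequence, leaves vectors with finitely many nonzero coefficients that converge
  to \<open>x\<close>.\<close>

lemma densely_defined_diag: "densely_defined (diag l)"
proof -
  have "x \<in> closure (dom (diag l))" for x
  proof -
    let ?f = "\<lambda>n. cinner x (e n) *\<^sub>C e n"
    have sm: "summable ?f"
      unfolding summable_basis_iff by (rule summable_bessel)
    define X where "X N = x - (suminf ?f - sum ?f {..<N})" for N
    have "(\<lambda>N. sum ?f {..<N}) \<longlonglongrightarrow> suminf ?f"
      using sm by (rule summable_LIMSEQ)
    then have "X \<longlonglongrightarrow> x - (suminf ?f - suminf ?f)"
      unfolding X_def by (intro tendsto_intros)
    then have lim: "X \<longlonglongrightarrow> x"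
      by simp
    have "X N \<in> dom (diag l)" for N
      unfolding in_dom_diag
    proof (rule summable_finite [of "{..<N}"])
      fix n assume "n \<notin> {..<N}"
      then have "cinner (sum ?f {..<N}) (e n) = 0"
        by (auto simp: cinner.sum_left cinner_scaleC_left cinner_basis intro!: sum.neutral)
      then have "cinner (X N) (e n) = 0"
        using cinner_suminf_basis [OF sm, of n] by (simp add: X_def cinner.diff_left)
      then show "(complex_of_real (l n) * cinner (X N) (e n)) *\<^sub>C e n = 0"
        by (simp add: scaleC.zero_left)
    qed simp
    with lim show ?thesis
      unfolding closure_sequential by blast
  qed
  then show ?thesis
    unfolding densely_defined_def by blast
qed

text \<open>\<open>diag l\<close> vanishes on the orthogonal complement of the sequence, so
  \<open>(diag l - z)\<^sup>-\<^sup>1\<close> is \<open>- 1 / z\<close> there; on \<open>e n\<close> it is \<open>1 / (l n - z) = (l n / (l n - z) - 1) / z\<close>.\<close>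

definition diag_resolvent :: "(nat \<Rightarrow> real) \<Rightarrow> complex \<Rightarrow> 'a \<Rightarrow> 'a" where
  "diag_resolvent l z y =
     (1 / z) *\<^sub>C ((\<Sum>n. (l n / (l n - z) * cinner y (e n)) *\<^sub>C e n) - y)"

lemma diag_resolvent:
  assumes z: "Im z \<noteq> 0"
  shows diag_resolvent_in_dom: "diag_resolvent l z y \<in> dom (diag l)"
    and diag_resolvent_right:
      "the (diag l (diag_resolvent l z y)) - z *\<^sub>C diag_resolvent l z y = y"
proof -
  let ?f = "\<lambda>n. (l n / (l n - z) * cinner y (e n)) *\<^sub>C e n"
  have z0: "z \<noteq> 0"
    using z by auto
  have sm: "summable ?f"
    by (rule summable_multiplier [OF cmod_real_div_le [OF z]])
  have "complex_of_real (l n) * cinner (diag_resolvent l z y) (e n) = l n / (l n - z) * cinner y (e n)" for n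
  proof -
    have "complex_of_real (l n) - z \<noteq> 0"
      using z by (auto simp: complex_eq_iff)
    \<comment> \<open>The coefficient of \<open>diag_resolvent l z y\<close> at \<open>e n\<close>
      is that of \<open>y\<close> divided by \<open>l n - z\<close>; multiplying by
      \<open>l n\<close> gives back the series \<open>?f\<close>.\<close>
    then have *: "(1 / z) * (l n / (l n - z) * t - t) = t / (l n - z)" for t
      using z0 by (simp add: field_simps)
    show ?thesis
      unfolding diag_resolvent_def cinner_scaleC_left cinner.diff_left cinner_suminf_basis [OF sm] *
      by simp
  qed
  then have eq: "(\<lambda>n. (complex_of_real (l n) * cinner (diag_resolvent l z y) (e n)) *\<^sub>C e n) = ?f"
    by (simp only:)
  show dom: "diag_resolvent l z y \<in> dom (diag l)"
    unfolding in_dom_diag eq by (rule sm)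
  show "the (diag l (diag_resolvent l z y)) - z *\<^sub>C diag_resolvent l z y = y"
    unfolding the_diag [OF dom] eq
    using z0 by (simp add: diag_resolvent_def scaleC_scaleC scaleC_one)
qed

lemma diag_in_SA: "diag l \<in> SA"
proof (rule SA_I)
  have surj: "\<exists>x\<in>dom (diag l). the (diag l x) - z *\<^sub>C x = y" if "Im z \<noteq> 0" for z y
    using diag_resolvent_right [OF that] diag_resolvent_in_dom [OF that] by blast
  show "\<exists>x\<in>dom (diag l). the (diag l x) - \<i> *\<^sub>C x = y" for y
    by (rule surj) simp
  show "\<exists>x\<in>dom (diag l). the (diag l x) - cnj \<i> *\<^sub>C x = y" for y
    by (rule surj) simp
qed (rule linear_operator_diag densely_defined_diag diag_symmetric; assumption)+

lemma resolvent_diag: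
  assumes "Im z \<noteq> 0"
  shows "blinfun_apply (resolvent (diag l) z) y = diag_resolvent l z y"
  using resolvent_left [OF diag_in_SA assms diag_resolvent_in_dom [OF assms], of l y]
  unfolding diag_resolvent_right [OF assms] .

lemma norm_diag_resolvent_basis:
  assumes z: "Im z \<noteq> 0"
  shows "norm (diag_resolvent l z (e m)) = 1 / cmod (l m - z)"
proof -
  have ne: "complex_of_real (l m) - z \<noteq> 0" "z \<noteq> 0"
    using z by (auto simp: complex_eq_iff)
  have "(\<lambda>n. (l n / (l n - z) * cinner (e m) (e n)) *\<^sub>C e n) =
      (\<lambda>n. if n = m then (l n / (l n - z)) *\<^sub>C e n else 0)"
    by (auto simp: cinner_basis scaleC.zero_left)
  then have "(\<Sum>n. (l n / (l n - z) * cinner (e m) (e n)) *\<^sub>C e n) = (l m / (l m - z)) *\<^sub>C e m"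
    by (simp add: sums_unique [symmetric, OF sums_single])
  then have "diag_resolvent l z (e m) = (1 / z) *\<^sub>C ((l m / (l m - z)) *\<^sub>C e m - 1 *\<^sub>C e m)"
    unfolding diag_resolvent_def scaleC_one by (simp only:)
  also have "\<dots> = (1 / z * (l m / (l m - z) - 1)) *\<^sub>C e m"
    by (simp only: scaleC.diff_left [symmetric] scaleC_scaleC)
  also have "1 / z * (l m / (l m - z) - 1) = 1 / (l m - z)"
    using ne by (simp add: field_simps)
  finally show ?thesis
    by (simp add: norm_scaleC norm_basis norm_divide)
qed

section \<open>Domains of diagonal operators\<close>

text \<open>From left to right, the resolvent inequality is tested at \<open>e n\<close>, where the
  norms are explicit; from right to left, the series of squared coefficients are compared.\<close>

lemma dom_diag_subset_iff:
  assumes l: "\<And>n. 1 \<le> l n" and m: "\<And>n. 1 \<le> m n"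
  shows "dom (diag m) \<subseteq> dom (diag l) \<longleftrightarrow> (\<exists>K. \<forall>n. l n \<le> K * m n)"
proof
  assume "dom (diag m) \<subseteq> dom (diag l)"
  then obtain C where C: "\<And>v. norm (diag_resolvent m \<i> v) \<le> C * norm (diag_resolvent l \<i> v)"
    using dom_subset_iff_resolvent_le [OF diag_in_SA diag_in_SA, of "\<i>" m l]
    by (auto simp: resolvent_diag)
  have "l n \<le> (2 * C) * m n" for n
  proof -
    have pos: "cmod (l n - \<i>) > 0" "cmod (m n - \<i>) > 0"
      using l [of n] m [of n] by (auto simp: complex_eq_iff)
    have "1 / cmod (m n - \<i>) \<le> C * (1 / cmod (l n - \<i>))"
      using C [of "e n"] by (simp add: norm_diag_resolvent_basis)
    then have le: "cmod (l n - \<i>) \<le> C * cmod (m n - \<i>)"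
      using pos by (simp add: field_simps)
    then have "0 < C * cmod (m n - \<i>)"
      using pos(1) by linarith
    then have "0 < C"
      using pos(2) by (simp add: zero_less_mult_iff)
    have "l n \<le> cmod (l n - \<i>)"
      using complex_Re_le_cmod [of "l n - \<i>"] by simp
    also note le
    \<comment> \<open>The factor \<open>2\<close> absorbs the shift:
      \<open>m n + 1 \<le> 2 * m n\<close> since \<open>1 \<le> m n\<close>.\<close>
    also have "C * cmod (m n - \<i>) \<le> C * (2 * m n)"
      using m [of n] norm_triangle_ineq4 [of "complex_of_real (m n)" "\<i>"] \<open>0 < C\<close>
      by (intro mult_left_mono) auto
    finally show ?thesis
      by simp
  qed
  then show "\<exists>K. \<forall>n. l n \<le> K * m n"
    by blast
next
  assume "\<exists>K. \<forall>n. l n \<le> K * m n"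
  then obtain K where K: "\<And>n. l n \<le> K * m n"
    by blast
  show "dom (diag m) \<subseteq> dom (diag l)"
  proof
    fix x assume x: "x \<in> dom (diag m)"
    have le: "norm ((cmod (l n * cinner x (e n)))\<^sup>2) \<le> K\<^sup>2 * (cmod (m n * cinner x (e n)))\<^sup>2" for n
    proof -
      have "(l n)\<^sup>2 \<le> (K * m n)\<^sup>2"
        using K l [of n] by (intro power_mono) auto
      then show ?thesis
        by (simp add: norm_mult power_mult_distrib mult_right_mono mult.assoc [symmetric])
    qed
    have "summable (\<lambda>n. K\<^sup>2 * (cmod (m n * cinner x (e n)))\<^sup>2)"
      using x unfolding in_dom_diag summable_basis_iff by (rule summable_mult)
    then show "x \<in> dom (diag l)"
      unfolding in_dom_diag summable_basis_iff
      by (rule summable_comparison_test' [where N = 0]) (rule le)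
  qed
qed

text \<open>Exponentials turn bounded differences into bounded ratios of eigenvalues; nonnegative
  exponents keep the eigenvalues at least \<open>1\<close>, as the comparison of domains
  assumes.\<close>

lemma E_dom_diag_exp_iff:
  assumes h: "\<And>n. 0 \<le> h n" and k: "\<And>n. 0 \<le> k n"
  shows "(diag (\<lambda>n. exp (h n)), diag (\<lambda>n. exp (k n))) \<in> E_dom \<longleftrightarrow> (h, k) \<in> E_linf"
proof -
  have *: "(\<exists>K. \<forall>n. exp (f n) \<le> K * exp (g n)) \<longleftrightarrow> (\<exists>K. \<forall>n. f n - g n \<le> K)"
    for f g :: "nat \<Rightarrow> real"
  proof
    assume "\<exists>K. \<forall>n. exp (f n) \<le> K * exp (g n)"
    then obtain K where K: "\<And>n. exp (f n - g n) \<le> K"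
      by (auto simp: exp_diff divide_le_eq)
    have "f n - g n \<le> K" for n
      \<comment> \<open>Since \<open>exp t\<close> is at least \<open>1 + t\<close>, the bound
        \<open>K\<close> on the ratios already bounds the differences.\<close>
      using K [of n] exp_ge_add_one_self [of "f n - g n"] by linarith
    then show "\<exists>K. \<forall>n. f n - g n \<le> K"
      by blast
  next
    assume "\<exists>K. \<forall>n. f n - g n \<le> K"
    then obtain K where "\<And>n. exp (f n - g n) \<le> exp K"
      by auto
    then show "\<exists>K. \<forall>n. exp (f n) \<le> K * exp (g n)"
      by (auto simp: exp_diff divide_le_eq)
  qed
  show ?thesis
    using dom_diag_subset_iff [of "\<lambda>n. exp (h n)" "\<lambda>n. exp (k n)"]
      dom_diag_subset_iff [of "\<lambda>n. exp (k n)" "\<lambda>n. exp (h n)"] h k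
    by (auto simp: E_dom_def E_linf_iff diag_in_SA * set_eq_subset)
qed

section \<open>Continuous dependence on the eigenvalues\<close>

text \<open>Blocks of the series are bounded by \<open>K\<close> and the corresponding blocks of
  Bessel's series for \<open>y\<close>, uniformly in \<open>t\<close>; so continuous partial sums
  converge uniformly.\<close>

lemma continuous_on_diag_resolvent:
  fixes l :: "'t::topological_space \<Rightarrow> nat \<Rightarrow> real"
  assumes cont: "\<And>n. continuous_on UNIV (\<lambda>t. l t n)" and z: "Im z \<noteq> 0"
  shows "continuous_on UNIV (\<lambda>t. diag_resolvent (l t) z y)"
proof -
  let ?f = "\<lambda>t n. (l t n / (l t n - z) * cinner y (e n)) *\<^sub>C e n"
  define K where "K = 1 + cmod z / \<bar>Im z\<bar>"
  have "uniformly_convergent_on UNIV (\<lambda>N t. \<Sum>n<N. ?f t n)"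
  proof (intro Cauchy_uniformly_convergent uniformly_Cauchy_onI')
    fix r :: real assume "0 < r"
    have "summable (\<lambda>n. K\<^sup>2 * (cmod (cinner y (e n)))\<^sup>2)"
      by (rule summable_mult [OF summable_bessel])
    then obtain N where N: "\<And>m n. m \<ge> N \<Longrightarrow> norm (\<Sum>k=m..<n. K\<^sup>2 * (cmod (cinner y (e k)))\<^sup>2) < r\<^sup>2"
      using \<open>0 < r\<close> unfolding summable_Cauchy by (meson zero_less_power)
    have "dist (\<Sum>n<m. ?f t n) (\<Sum>n<n. ?f t n) < r" if "m \<ge> N" "n > m" for t m n
    proof (rule power_less_imp_less_base)
      have "{..<n} - {..<m} = {m..<n}"
        by auto
      then have "(\<Sum>n<n. ?f t n) - (\<Sum>n<m. ?f t n) = (\<Sum>k=m..<n. ?f t k)"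
        using that sum_diff [of "{..<n}" "{..<m}" "?f t"] by simp
      then have "(dist (\<Sum>n<m. ?f t n) (\<Sum>n<n. ?f t n))\<^sup>2 = (norm (\<Sum>k=m..<n. ?f t k))\<^sup>2"
        by (simp only: dist_norm norm_minus_commute [of "\<Sum>n<m. ?f t n"])
      also have "\<dots> = (\<Sum>k=m..<n. (cmod (l t k / (l t k - z) * cinner y (e k)))\<^sup>2)"
        by (rule norm_sum_basis) simp
      also have "\<dots> \<le> (\<Sum>k=m..<n. K\<^sup>2 * (cmod (cinner y (e k)))\<^sup>2)"
        unfolding K_def norm_mult power_mult_distrib
        by (intro sum_mono mult_right_mono power_mono cmod_real_div_le z) auto
      also have "\<dots> < r\<^sup>2"
        using N [OF that(1), of n] by simp
      finally show "(dist (\<Sum>n<m. ?f t n) (\<Sum>n<n. ?f t n))\<^sup>2 < r\<^sup>2" .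
    qed (use \<open>0 < r\<close> in simp)
    then show "\<exists>M. \<forall>t\<in>UNIV. \<forall>m\<ge>M. \<forall>n>m. dist (\<Sum>n<m. ?f t n) (\<Sum>n<n. ?f t n) < r"
      by blast
  qed
  then have "uniform_limit UNIV (\<lambda>N t. \<Sum>n<N. ?f t n) (\<lambda>t. suminf (?f t)) sequentially"
    by (simp add: uniformly_convergent_uniform_limit_iff suminf_eq_lim)
  moreover have "complex_of_real (l t n) - z \<noteq> 0" for t n
    using z by (auto simp: complex_eq_iff)
  then have "continuous_on UNIV (\<lambda>t. \<Sum>n<N. ?f t n)" for N
    by (intro continuous_intros scaleC.continuous_on cont) auto
  ultimately have "continuous_on UNIV (\<lambda>t. suminf (?f t))"
    by (intro uniform_limit_theorem [of _ "\<lambda>N t. \<Sum>n<N. ?f t n" sequentially]) auto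
  then show ?thesis
    unfolding diag_resolvent_def
    by (intro scaleC.continuous_on continuous_intros)
qed

text \<open>The pullback topology reduces continuity to that of the resolvent, and the strong
  operator topology tests it one vector at a time.\<close>

lemma continuous_map_diag:
  fixes l :: "'t::topological_space \<Rightarrow> nat \<Rightarrow> real"
  assumes "\<And>n. continuous_on UNIV (\<lambda>t. l t n)"
  shows "continuous_map euclidean SRT (\<lambda>t. diag (l t))"
  unfolding SRT_def
proof (rule continuous_map_pullback')
  show "continuous_map euclidean strong_operator_topology ((\<lambda>A. resolvent A \<i>) \<circ> (\<lambda>t. diag (l t)))"
    using continuous_on_diag_resolvent [OF assms, of "\<i>"]
    by (simp add: continuous_on_strong_operator_topo_iff_coordinatewise resolvent_diag)
qed (simp add: diag_in_SA subset_iff)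

end

text \<open>Splitting into positive and negative parts, kept apart on even and odd indices, replaces a
  real sequence by a nonnegative one in the same relation.\<close>

definition split_parts :: "(nat \<Rightarrow> real) \<Rightarrow> nat \<Rightarrow> real" where
  "split_parts a n = max 0 (if even n then a (n div 2) else - a (n div 2))"

lemma split_parts_nonneg: "0 \<le> split_parts a n"
  by (simp add: split_parts_def)

text \<open>A real number is the difference of its two parts, which costs a factor \<open>2\<close>;
  conversely, taking either part does not increase distances.\<close>

lemma E_linf_split_parts_iff: "(split_parts a, split_parts b) \<in> E_linf \<longleftrightarrow> (a, b) \<in> E_linf"
proof
  assume "(split_parts a, split_parts b) \<in> E_linf"
  then obtain K where K: "\<And>n. \<bar>split_parts a n - split_parts b n\<bar> \<le> K"
    by (auto simp: E_linf_def bdd_above_def)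
  have "\<bar>a n - b n\<bar> \<le> 2 * K" for n
    using K [of "2 * n"] K [of "2 * n + 1"] by (simp add: split_parts_def)
  then show "(a, b) \<in> E_linf"
    by (auto simp: E_linf_def bdd_above_def)
next
  assume "(a, b) \<in> E_linf"
  then obtain K where K: "\<And>n. \<bar>a n - b n\<bar> \<le> K"
    by (auto simp: E_linf_def bdd_above_def)
  have "\<bar>split_parts a n - split_parts b n\<bar> \<le> K" for n
    using K [of "n div 2"] unfolding split_parts_def by (cases "even n"; simp; linarith)
  then show "(split_parts a, split_parts b) \<in> E_linf"
    by (auto simp: E_linf_def bdd_above_def)
qed

lemma continuous_on_split_parts: "continuous_on UNIV (\<lambda>a. split_parts a n)"
  unfolding split_parts_def
  by (cases "even n") (auto intro!: continuous_intros)

section \<open>Assembly of the two reductions\<close>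

lemma E_dom_subset: "E_dom \<subseteq> SA \<times> SA"
  by (auto simp: E_dom_def)

theorem theorem3p1:
  assumes separable: "separable_space (euclidean :: 'a::complex_hilbert topology)"
    and infinite_dimensional: "\<nexists>B :: 'a set. finite B \<and> complex_vector.span B = UNIV"
  shows "fsigma_in (prod_topology SRT SRT) (E_dom :: (('a \<rightharpoonup> 'a) \<times> ('a \<rightharpoonup> 'a)) set) \<and>
    continuously_reducible SRT (E_dom :: (('a \<rightharpoonup> 'a) \<times> ('a \<rightharpoonup> 'a)) set)
      (powertop_real UNIV) E_linf \<and>
    continuously_reducible (powertop_real UNIV) E_linf
      SRT (E_dom :: (('a \<rightharpoonup> 'a) \<times> ('a \<rightharpoonup> 'a)) set)"
proof (intro conjI)
  obtain c :: "nat \<Rightarrow> 'a" where c: "closure (range c) = UNIV"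
    using dense_sequence [OF separable] .
  have E_dom_eq: "(E_dom :: (('a \<rightharpoonup> 'a) \<times> ('a \<rightharpoonup> 'a)) set) = {(A, B). A \<in> topspace SRT \<and> B \<in> topspace SRT \<and>
      (log_resolvent c A, log_resolvent c B) \<in> E_linf}"
    using E_dom_iff_log_resolvent [OF _ _ c] E_dom_subset unfolding topspace_SRT by blast
  show "fsigma_in (prod_topology SRT SRT) (E_dom :: (('a \<rightharpoonup> 'a) \<times> ('a \<rightharpoonup> 'a)) set)"
    unfolding E_dom_eq by (rule fsigma_in_vimage_E_linf [OF continuous_map_log_resolvent])
  show "continuously_reducible SRT (E_dom :: (('a \<rightharpoonup> 'a) \<times> ('a \<rightharpoonup> 'a)) set) (powertop_real UNIV) E_linf"
    unfolding continuously_reducible_def topspace_SRT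
    by (intro exI [of _ "log_resolvent c"] conjI ballI continuous_map_log_resolvent
        E_dom_iff_log_resolvent c)
  obtain e :: "nat \<Rightarrow> 'a" where e: "\<And>m n. cinner (e m) (e n) = (if m = n then 1 else 0)"
    using ex_orthonormal_sequence [OF infinite_dimensional] by blast
  interpret orthonormal_sequence e
    by unfold_locales (rule e)
  have "continuous_on UNIV (\<lambda>a. exp (split_parts a n))" for n
    by (intro continuous_on_exp continuous_on_split_parts)
  \<comment> \<open>The product topology is the euclidean topology of the function type, for which
    \<open>continuous_map_diag\<close> is stated.\<close>
  then have "continuous_map (powertop_real UNIV) SRT (\<lambda>a. diag (\<lambda>n. exp (split_parts a n)))"
    unfolding euclidean_product_topology by (rule continuous_map_diag)
  moreover have "(a, b) \<in> E_linf \<longleftrightarrow>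
      (diag (\<lambda>n. exp (split_parts a n)), diag (\<lambda>n. exp (split_parts b n))) \<in> E_dom" for a b
    by (subst E_dom_diag_exp_iff) (simp_all only: split_parts_nonneg E_linf_split_parts_iff)
  ultimately show "continuously_reducible (powertop_real UNIV) E_linf
      SRT (E_dom :: (('a \<rightharpoonup> 'a) \<times> ('a \<rightharpoonup> 'a)) set)"
    unfolding continuously_reducible_def by blast
qed

end
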